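(* Let $\lambda\in\mathfrak h^*_\mathbb{C}$ satisfy $\operatorname{Re}(\lambda-\rho)\in\mathcal C^*$. Then the series $$E^\sharp_\lambda(g)=\sum_{w\in W} a(g)^{w\lambda+\rho}\,c(\lambda,w),\qquad c(\lambda,w)=\prod_{\alpha\in\Phi_w}\frac{\xi(\langle\lambda,\alpha^\vee\rangle)}{\xi(1+\langle\lambda,\alpha^\vee\rangle)},$$ converges absolutely for $g\in UA_{\mathfrak C}K$, and in fact uniformly for $a(g)$ lying in any fixed compact subset of $A_{\mathfrak C}$.
   Context: Setting: $A=(a_{ij})_{i,j\in I}$, $I=\{1,\dots,r\}$, a nonsingular symmetrizable generalized Cartan matrix with real realization $(\mathfrak h,\{\alpha_i\},\{\alpha_i^\vee\})$, $\langle\alpha_j,\alpha_i^\vee\rangle=a_{ij}$; $\Phi_+$ positive roots, $\Phi_-=-\Phi_+$, $W$ the Weyl group, $\Phi_w=\Phi_+\cap w^{-1}\Phi_-$ (all real roots); for a real root $\alpha=w\alpha_i$, $\alpha^\vee=w\alpha_i^\vee$. $\rho$: $\langle\rho,\alpha_i^\vee\rangle=1$. $\mathcal C^*=\{\lambda\in\mathfrak h^*:\langle\lambda,\alpha_i^\vee\rangle>0\ \forall i\}$ (for complex $\lambda$, $\operatorname{Re}$ taken componentwise). $\mathcal C=\{x\in\mathfrak h:\langle\alpha_i,x\rangle>0\ \forall i\}$, $\mathfrak C$ the interior of the Tits cone $\bigcup_{w}w\overline{\mathcal C}$, $A_{\mathfrak C}=\exp(\mathfrak C)$. $\xi(s)=\pi^{-s/2}\Gamma(s/2)\zeta(s)$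 is the completed Riemann zeta function. $G_\mathbb{R}$ is the representation-theoretic real Kac--Moody group with Iwasawa decomposition $G_\mathbb{R}=UA^+K$ (unique), $a(g)$ the $A^+$-component, $A^+=\exp(\mathfrak h)$, and for $a=\exp(H)$, $a^\mu=e^{\langle\mu,H\rangle}$. *)

theory Defs
  imports "HOL-Analysis.Analysis"
begin

section \<open>Cartan matrices and Kac--Moody data\<close>

definition generalized_cartan_matrix :: "int^'i^'i \<Rightarrow> bool" where
  "generalized_cartan_matrix A \<longleftrightarrow>
     (\<forall>i. A $ i $ i = 2) \<and>
     (\<forall>i j. i \<noteq> j \<longrightarrow> A $ i $ j \<le> 0) \<and>
     (\<forall>i j. A $ i $ j = 0 \<longrightarrow> A $ j $ i = 0)"

definition symmetrizable :: "int^'i^'i \<Rightarrow> bool" where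
  "symmetrizable A \<longleftrightarrow>
     (\<exists>d :: 'i \<Rightarrow> real. (\<forall>i. d i \<noteq> 0) \<and>
        (\<forall>i j. d i * of_int (A $ i $ j) = d j * of_int (A $ j $ i)))"

text \<open>
  The type \<^typ>\<open>'h\<close> is the real Cartan subalgebra, \<^typ>\<open>'g\<close> the real Kac--Moody algebra, and
  \<^typ>\<open>'v\<close> the real highest weight module on which the group is realised. Elements of the real
  (complexified) dual of \<^typ>\<open>'h\<close> are real-linear functions into \<^typ>\<open>real\<close> (\<^typ>\<open>complex\<close>).
\<close>

record ('i, 'h, 'g, 'v) kac_moody_datum =
  cartan :: "int^'i^'i"
  sroot :: "'i \<Rightarrow> 'h \<Rightarrow> real"
  scoroot :: "'i \<Rightarrow> 'h"
  bracket :: "'g \<Rightarrow> 'g \<Rightarrow> 'g"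
  cart :: "'h \<Rightarrow> 'g"
  chev_e :: "'i \<Rightarrow> 'g"
  chev_f :: "'i \<Rightarrow> 'g"
  act :: "'g \<Rightarrow> 'v \<Rightarrow> 'v"

definition realization :: "('i::finite, 'h::euclidean_space, 'g, 'v) kac_moody_datum \<Rightarrow> bool" where
  "realization D \<longleftrightarrow>
     (\<forall>i. linear (sroot D i)) \<and>
     (\<forall>c :: 'i \<Rightarrow> real. (\<forall>x. (\<Sum>i\<in>UNIV. c i * sroot D i x) = 0) \<longrightarrow> (\<forall>i. c i = 0)) \<and>
     (\<forall>c :: 'i \<Rightarrow> real. (\<Sum>i\<in>UNIV. c i *\<^sub>R scoroot D i) = 0 \<longrightarrow> (\<forall>i. c i = 0)) \<and>
     (\<forall>i j. sroot D j (scoroot D i) = of_int (cartan D $ i $ j)) \<and>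
     DIM('h) = 2 * CARD('i) - rank (map_matrix real_of_int (cartan D))"

definition lie_algebra :: "('g::real_vector \<Rightarrow> 'g \<Rightarrow> 'g) \<Rightarrow> bool" where
  "lie_algebra br \<longleftrightarrow>
     (\<forall>x. linear (br x)) \<and> (\<forall>y. linear (\<lambda>x. br x y)) \<and>
     (\<forall>x. br x x = 0) \<and>
     (\<forall>x y z. br x (br y z) + br y (br z x) + br z (br x y) = 0)"

text \<open>
  The Kac--Moody algebra of a symmetrizable matrix: generated by the Cartan subalgebra and the
  Chevalley generators, subject to the Chevalley--Serre relations, and without nonzero ideals
  meeting the Cartan subalgebra trivially. (By Gabber--Kac, the Serre relations and the last
  condition each determine the same algebra in the symmetrizable case.)
\<close>

definition kac_moody_algebra ::
  "('i::finite, 'h::euclidean_space, 'g::real_vector, 'v) kac_moody_datum \<Rightarrow> bool" where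
  "kac_moody_algebra D \<longleftrightarrow>
     lie_algebra (bracket D) \<and> linear (cart D) \<and> inj (cart D) \<and>
     (\<forall>x y. bracket D (cart D x) (cart D y) = 0) \<and>
     (\<forall>x i. bracket D (cart D x) (chev_e D i) = sroot D i x *\<^sub>R chev_e D i) \<and>
     (\<forall>x i. bracket D (cart D x) (chev_f D i) = - (sroot D i x *\<^sub>R chev_f D i)) \<and>
     (\<forall>i j. bracket D (chev_e D i) (chev_f D j) = (if i = j then cart D (scoroot D i) else 0)) \<and>
     (\<forall>i j. i \<noteq> j \<longrightarrow>
        (bracket D (chev_e D i) ^^ nat (1 - cartan D $ i $ j)) (chev_e D j) = 0 \<and>
        (bracket D (chev_f D i) ^^ nat (1 - cartan D $ i $ j)) (chev_f D j) = 0) \<and>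
     (\<forall>S. subspace S \<and> range (cart D) \<union> range (chev_e D) \<union> range (chev_f D) \<subseteq> S \<and>
          (\<forall>x\<in>S. \<forall>y\<in>S. bracket D x y \<in> S) \<longrightarrow> S = UNIV) \<and>
     (\<forall>J. subspace J \<and> (\<forall>x. \<forall>y\<in>J. bracket D x y \<in> J) \<and> J \<inter> range (cart D) = {0}
          \<longrightarrow> J = {0})"

text \<open>
  The irreducible highest weight module with regular dominant integral highest weight. The inner
  product of the type \<^typ>\<open>'v\<close> is the positive definite contravariant form, which such a module
  carries (uniquely up to scaling) in the symmetrizable case.
\<close>

definition highest_weight_module ::
  "('i::finite, 'h::euclidean_space, 'g::real_vector, 'v::real_inner) kac_moody_datum \<Rightarrow> bool" where
  "highest_weight_module D \<longleftrightarrow>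
     (\<forall>x. linear (act D x)) \<and> (\<forall>v. linear (\<lambda>x. act D x v)) \<and>
     (\<forall>x y v. act D (bracket D x y) v = act D x (act D y v) - act D y (act D x v)) \<and>
     (\<forall>S. subspace S \<and> (\<forall>x. \<forall>v\<in>S. act D x v \<in> S) \<longrightarrow> S = {0} \<or> S = UNIV) \<and>
     (\<exists>\<Lambda> v\<^sub>0. linear \<Lambda> \<and> (\<forall>i. \<exists>n::nat. n > 0 \<and> \<Lambda> (scoroot D i) = real n) \<and>
        v\<^sub>0 \<noteq> 0 \<and> (\<forall>x. act D (cart D x) v\<^sub>0 = \<Lambda> x *\<^sub>R v\<^sub>0) \<and> (\<forall>i. act D (chev_e D i) v\<^sub>0 = 0)) \<and>
     (\<forall>i v w. act D (chev_e D i) v \<bullet> w = v \<bullet> act D (chev_f D i) w) \<and>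
     (\<forall>x v w. act D (cart D x) v \<bullet> w = v \<bullet> act D (cart D x) w)"


section \<open>Weyl group, roots and the Tits cone\<close>

definition simple_reflection ::
  "('i::finite, 'h::euclidean_space, 'g, 'v) kac_moody_datum \<Rightarrow> 'i \<Rightarrow> 'h \<Rightarrow> 'h" where
  "simple_reflection D i x = x - sroot D i x *\<^sub>R scoroot D i"

inductive_set weyl_group :: "('i::finite, 'h::euclidean_space, 'g, 'v) kac_moody_datum \<Rightarrow> ('h \<Rightarrow> 'h) set"
  for D where
  weyl_id: "id \<in> weyl_group D"
| weyl_step: "w \<in> weyl_group D \<Longrightarrow> simple_reflection D i \<circ> w \<in> weyl_group D"

text \<open>The contragredient action on (real or complex) linear functionals.\<close>

definition dual_act :: "('h \<Rightarrow> 'h) \<Rightarrow> ('h \<Rightarrow> 'a) \<Rightarrow> 'h \<Rightarrow> 'a" where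
  "dual_act w \<mu> = \<mu> \<circ> inv w"

definition roots ::
  "('i::finite, 'h::euclidean_space, 'g::real_vector, 'v) kac_moody_datum \<Rightarrow> ('h \<Rightarrow> real) set" where
  "roots D = {\<beta>. linear \<beta> \<and> \<beta> \<noteq> (\<lambda>_. 0) \<and>
     (\<exists>y. y \<noteq> 0 \<and> (\<forall>x. bracket D (cart D x) y = \<beta> x *\<^sub>R y))}"

definition pos_roots ::
  "('i::finite, 'h::euclidean_space, 'g::real_vector, 'v) kac_moody_datum \<Rightarrow> ('h \<Rightarrow> real) set" where
  "pos_roots D = {\<beta> \<in> roots D. \<exists>n :: 'i \<Rightarrow> nat. \<beta> = (\<lambda>x. \<Sum>i\<in>UNIV. real (n i) * sroot D i x)}"

definition neg_roots ::
  "('i::finite, 'h::euclidean_space, 'g::real_vector, 'v) kac_moody_datum \<Rightarrow> ('h \<Rightarrow> real) set" where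
  "neg_roots D = (\<lambda>\<beta> x. - \<beta> x) ` pos_roots D"

definition inversion_set ::
  "('i::finite, 'h::euclidean_space, 'g::real_vector, 'v) kac_moody_datum
     \<Rightarrow> ('h \<Rightarrow> 'h) \<Rightarrow> ('h \<Rightarrow> real) set" where
  "inversion_set D w = pos_roots D \<inter> dual_act (inv w) ` neg_roots D"

text \<open>Meaningful for real roots only; the value is independent of the representation
  \<open>\<beta> = w \<alpha>\<^sub>i\<close>.\<close>

definition coroot ::
  "('i::finite, 'h::euclidean_space, 'g, 'v) kac_moody_datum \<Rightarrow> ('h \<Rightarrow> real) \<Rightarrow> 'h" where
  "coroot D \<beta> = (THE y. \<exists>w\<in>weyl_group D. \<exists>i. \<beta> = dual_act w (sroot D i) \<and> y = w (scoroot D i))"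

definition chamber :: "('i::finite, 'h::euclidean_space, 'g, 'v) kac_moody_datum \<Rightarrow> 'h set" where
  "chamber D = {x. \<forall>i. sroot D i x > 0}"

definition dual_chamber ::
  "('i::finite, 'h::euclidean_space, 'g, 'v) kac_moody_datum \<Rightarrow> ('h \<Rightarrow> real) set" where
  "dual_chamber D = {\<mu>. linear \<mu> \<and> (\<forall>i. \<mu> (scoroot D i) > 0)}"

definition tits_cone :: "('i::finite, 'h::euclidean_space, 'g, 'v) kac_moody_datum \<Rightarrow> 'h set" where
  "tits_cone D = (\<Union>w\<in>weyl_group D. w ` closure (chamber D))"


section \<open>The real Kac--Moody group and its Iwasawa decomposition\<close>

text \<open>
  All exponentials below are pointwise norm-convergent: the Chevalley generators act locally
  nilpotently, and each vector is a finite sum of eigenvectors of the Cartan subalgebra.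
\<close>

definition op_exp :: "('v::real_normed_vector \<Rightarrow> 'v) \<Rightarrow> 'v \<Rightarrow> 'v" where
  "op_exp T v = (\<Sum>n. (T ^^ n) v /\<^sub>R fact n)"

inductive_set km_group_min ::
  "('i::finite, 'h, 'g, 'v::real_inner) kac_moody_datum \<Rightarrow> ('v \<Rightarrow> 'v) set"
  for D where
  km_id: "id \<in> km_group_min D"
| km_e: "g \<in> km_group_min D \<Longrightarrow> op_exp (\<lambda>v. t *\<^sub>R act D (chev_e D i) v) \<circ> g \<in> km_group_min D"
| km_f: "g \<in> km_group_min D \<Longrightarrow> op_exp (\<lambda>v. t *\<^sub>R act D (chev_f D i) v) \<circ> g \<in> km_group_min D"

text \<open>
  The completion of the group generated by the one-parameter subgroups of the Chevalley generators,
  with respect to the topology whose basic neighbourhoods of the identity are the pointwise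
  stabilisers of finite sets of vectors; it is realised as a closure inside the automorphism group
  of the module.
\<close>

definition km_group :: "('i::finite, 'h, 'g, 'v::real_inner) kac_moody_datum \<Rightarrow> ('v \<Rightarrow> 'v) set" where
  "km_group D = {g. linear g \<and> bij g \<and>
     (\<forall>S. finite S \<longrightarrow> (\<exists>g\<^sub>0\<in>km_group_min D. \<forall>v\<in>S. g v = g\<^sub>0 v))}"

definition weight_space ::
  "('i::finite, 'h, 'g, 'v::real_inner) kac_moody_datum \<Rightarrow> ('h \<Rightarrow> real) \<Rightarrow> 'v set" where
  "weight_space D \<mu> = {v. \<forall>x. act D (cart D x) v = \<mu> x *\<^sub>R v}"

text \<open>\<open>U\<close>: the elements acting unipotently upper triangularly with respect to the weight
  decomposition.\<close>

definition unipotent_subgroup ::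
  "('i::finite, 'h, 'g, 'v::real_inner) kac_moody_datum \<Rightarrow> ('v \<Rightarrow> 'v) set" where
  "unipotent_subgroup D = {u \<in> km_group D. \<forall>\<mu>. \<forall>v\<in>weight_space D \<mu>.
     u v - v \<in> span (\<Union>n\<in>{n :: 'i \<Rightarrow> nat. \<exists>i. n i \<noteq> 0}.
       weight_space D (\<lambda>x. \<mu> x + (\<Sum>i\<in>UNIV. real (n i) * sroot D i x)))}"

definition unitary_subgroup ::
  "('i::finite, 'h, 'g, 'v::real_inner) kac_moody_datum \<Rightarrow> ('v \<Rightarrow> 'v) set" where
  "unitary_subgroup D = {k \<in> km_group D. \<forall>v w. k v \<bullet> k w = v \<bullet> w}"

definition torus_exp ::
  "('i::finite, 'h, 'g, 'v::real_inner) kac_moody_datum \<Rightarrow> 'h \<Rightarrow> 'v \<Rightarrow> 'v" where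
  "torus_exp D x = op_exp (act D (cart D x))"

definition torus_log ::
  "('i::finite, 'h, 'g, 'v::real_inner) kac_moody_datum \<Rightarrow> ('v \<Rightarrow> 'v) \<Rightarrow> 'h" where
  "torus_log D a = (THE x. a = torus_exp D x)"

text \<open>\<open>a\<^sup>\<mu>\<close> for \<open>a\<close> in \<open>A\<^sup>+\<close>.\<close>

definition torus_power ::
  "('i::finite, 'h, 'g, 'v::real_inner) kac_moody_datum \<Rightarrow> ('v \<Rightarrow> 'v) \<Rightarrow> ('h \<Rightarrow> complex) \<Rightarrow> complex" where
  "torus_power D a \<mu> = exp (\<mu> (torus_log D a))"

text \<open>The component \<open>a(g)\<close> in the Iwasawa decomposition \<open>U A\<^sup>+ K\<close>.\<close>

definition iwasawa_a ::
  "('i::finite, 'h, 'g, 'v::real_inner) kac_moody_datum \<Rightarrow> ('v \<Rightarrow> 'v) \<Rightarrow> 'v \<Rightarrow> 'v" where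
  "iwasawa_a D g = (THE a. a \<in> range (torus_exp D) \<and>
     (\<exists>u\<in>unipotent_subgroup D. \<exists>k\<in>unitary_subgroup D. g = u \<circ> a \<circ> k))"

text \<open>\<open>U A\<^sub>C K\<close>, where \<open>A\<^sub>C\<close> is the exponential of the interior of the Tits cone.\<close>

definition tits_domain ::
  "('i::finite, 'h::euclidean_space, 'g, 'v::real_inner) kac_moody_datum \<Rightarrow> ('v \<Rightarrow> 'v) set" where
  "tits_domain D = {u \<circ> a \<circ> k | u a k. u \<in> unipotent_subgroup D \<and>
     a \<in> torus_exp D ` interior (tits_cone D) \<and> k \<in> unitary_subgroup D}"


section \<open>The completed zeta function and the series\<close>

definition zeta_series :: "complex \<Rightarrow> complex" where
  "zeta_series s = (\<Sum>n. of_nat (Suc n) powr (- s))"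

text \<open>The Dirichlet series where it converges absolutely, and elsewhere its analytic continuation
  (with an arbitrary value at the pole \<open>1\<close>).\<close>

definition riemann_zeta :: "complex \<Rightarrow> complex" where
  "riemann_zeta s = (if Re s > 1 then zeta_series s
     else (SOME f. f holomorphic_on - {1} \<and> (\<forall>z. Re z > 1 \<longrightarrow> f z = zeta_series z)) s)"

definition completed_zeta :: "complex \<Rightarrow> complex" where
  "completed_zeta s = of_real pi powr (- s / 2) * Gamma (s / 2) * riemann_zeta s"

definition c_factor ::
  "('i::finite, 'h::euclidean_space, 'g::real_vector, 'v) kac_moody_datum
     \<Rightarrow> ('h \<Rightarrow> complex) \<Rightarrow> ('h \<Rightarrow> 'h) \<Rightarrow> complex" where
  "c_factor D \<mu> w = (\<Prod>\<beta>\<in>inversion_set D w.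
     completed_zeta (\<mu> (coroot D \<beta>)) / completed_zeta (1 + \<mu> (coroot D \<beta>)))"

definition E_sharp_term ::
  "('i::finite, 'h::euclidean_space, 'g::real_vector, 'v::real_inner) kac_moody_datum
     \<Rightarrow> ('h \<Rightarrow> real) \<Rightarrow> ('h \<Rightarrow> complex) \<Rightarrow> ('v \<Rightarrow> 'v) \<Rightarrow> ('h \<Rightarrow> 'h) \<Rightarrow> complex" where
  "E_sharp_term D \<rho> \<mu> g w =
     torus_power D (iwasawa_a D g) (\<lambda>x. dual_act w \<mu> x + of_real (\<rho> x)) * c_factor D \<mu> w"

definition E_sharp ::
  "('i::finite, 'h::euclidean_space, 'g::real_vector, 'v::real_inner) kac_moody_datum
     \<Rightarrow> ('h \<Rightarrow> real) \<Rightarrow> ('h \<Rightarrow> complex) \<Rightarrow> ('v \<Rightarrow> 'v) \<Rightarrow> complex" where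
  "E_sharp D \<rho> \<mu> g = (\<Sum>\<^sub>\<infinity>w\<in>weyl_group D. E_sharp_term D \<rho> \<mu> g w)"

end

theory Submission
  imports Defs
begin

text \<open>
  The coefficients \<open>c(\<lambda>, w)\<close> are uniformly bounded: for \<open>Re s > 1\<close> the quotient
  \<open>\<xi>(s) / \<xi>(1 + s)\<close> is \<open>O((Re s - 1)\<^bsup>-1/2\<^esup>)\<close>, so among the real coroots, which are nonnegative
  integral combinations of the simple ones, only finitely many give a factor larger than 1.

  It remains to sum \<open>exp \<langle>w Re \<lambda>, x\<rangle>\<close>. In the open chamber, \<open>x - w x\<close> is a combination of simple
  coroots with coefficients in the nonnegative integral span of the simple roots; as \<open>Re \<lambda> - \<rho>\<close> is
  dominant and \<open>w\<close> is determined by \<open>w \<rho>\<close>, the sum is dominated by a product of geometric series.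
  Convergence passes to the Weyl translates of the chamber and, the exponential being convex, to
  their convex hull, whose interior contains the interior of the Tits cone.

  The facts about roots come from sl2-strings in the Kac--Moody algebra, and the uniqueness of the
  Iwasawa component from comparing norms of the highest weight vector \<open>v\<^sub>0\<close> and of the \<open>f\<^sub>i v\<^sub>0\<close>.
\<close>

section \<open>Quotients of completed zeta values\<close>

text \<open>The margin of \<open>Re \<mu>\<close> over \<open>\<rho>\<close> on the simple coroots
  is spent twice. It keeps all arguments of \<open>completed_zeta\<close> in a half-plane
  \<open>Re s \<ge> a\<close> with \<open>a > 1\<close>, where zeta is bounded; passing from
  \<open>s\<close> to \<open>1 + s\<close> moves the Gamma factor by half a step, which is the
  origin of the exponent \<open>-1/2\<close>. It also lets the orbit sum be compared with that of
  rho, whose defects are distinct multi-indices.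

  The obstacle is that \<open>roots\<close> only asks for a nonzero weight vector. That roots have
  coefficients of one sign, that reflections preserve them, and that \<open>s i\<close> takes no
  positive root but \<open>\<alpha> i\<close> out of the positive roots must be extracted from the
  generators. After that, words and the exchange condition carry the Weyl group combinatorics.

  Symmetrizability supplies an invariant form, which turns the coefficients of a real root into
  those of its coroot. Working with the hull of the chambers avoids proving that the Tits cone is
  convex.\<close>

lemma norm_shift_half_quotient_le:
  fixes z :: complex
  assumes "Re z > 1 / 2"
  shows "(norm (z + 1 / 2) / norm z)\<^sup>2 \<le> (Re z + 1 / 2) / (Re z - 1 / 2)"
proof -
  \<comment> \<open>After clearing denominators the two sides differ by
    \<open>(Re z + 1/2) / 4 + (Im z)^2\<close>. The bound has the form
    \<open>h (x + 1) / h x\<close> with \<open>h x = x - 1/2\<close>, which suits a product over the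
    shifts \<open>z + n\<close>.\<close>
  have "((Re z + 1 / 2)\<^sup>2 + (Im z)\<^sup>2) * (Re z - 1 / 2)
      = (Re z + 1 / 2) * ((Re z)\<^sup>2 + (Im z)\<^sup>2) - (Re z + 1 / 2) / 4 - (Im z)\<^sup>2"
    by (simp add: power2_eq_square algebra_simps)
  also have "\<dots> \<le> (Re z + 1 / 2) * ((Re z)\<^sup>2 + (Im z)\<^sup>2)"
    proof -
    have "0 \<le> (Re z + 1 / 2) / 4" using assms by simp
    then show ?thesis using zero_le_power2[of "Im z"] by linarith
  qed
  finally have le: "((Re z + 1 / 2)\<^sup>2 + (Im z)\<^sup>2) * (Re z - 1 / 2) \<le> (Re z + 1 / 2) * ((Re z)\<^sup>2 + (Im z)\<^sup>2)" .
  have pos: "0 < (Re z)\<^sup>2 + (Im z)\<^sup>2"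
    using assms by (intro add_pos_nonneg) auto
  have "(norm (z + 1 / 2) / norm z)\<^sup>2 = ((Re z + 1 / 2)\<^sup>2 + (Im z)\<^sup>2) / ((Re z)\<^sup>2 + (Im z)\<^sup>2)"
    by (simp add: power_divide cmod_power2)
  also have "\<dots> \<le> (Re z + 1 / 2) / (Re z - 1 / 2)"
  proof -
    have "a / p \<le> b / q" if "a * q \<le> b * p" "0 < p" "0 < q" for a b p q :: real
      using that by (simp add: divide_simps)
    from this[OF le pos] assms show ?thesis by linarith
  qed
  finally show ?thesis .
qed

text \<open>Comparing the factors of the Euler products of \<open>\<Gamma>(z)\<close> and \<open>\<Gamma>(z + 1/2)\<close>
  makes the product of the bounds telescope.\<close>

lemma norm_Gamma_half_quotient_le:
  fixes z :: complex
  assumes "Re z > 1 / 2"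
  shows "(norm (Gamma z / Gamma (z + 1 / 2)))\<^sup>2 \<le> 1 / (Re z - 1 / 2)"
proof -
  let ?x = "Re z"
  have prod: "(norm (pochhammer (z + 1 / 2) n / pochhammer z n))\<^sup>2 \<le> (?x + real n - 1 / 2) / (?x - 1 / 2)" for n
  proof (induction n)
    case 0
    show ?case using assms by simp
  next
    case (Suc n)
    have "(norm (pochhammer (z + 1 / 2) (Suc n) / pochhammer z (Suc n)))\<^sup>2
        = (norm (pochhammer (z + 1 / 2) n / pochhammer z n))\<^sup>2 *
          (norm ((z + of_nat n) + 1 / 2) / norm (z + of_nat n))\<^sup>2"
      by (simp add: pochhammer_Suc norm_divide norm_mult power_mult_distrib power_divide add_ac)
    also have "\<dots> \<le> ((?x + real n - 1 / 2) / (?x - 1 / 2)) *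
        ((?x + real n + 1 / 2) / (?x + real n - 1 / 2))"
      using norm_shift_half_quotient_le[of "z + of_nat n"] assms
      by (intro mult_mono Suc.IH) auto
    also have "\<dots> = (?x + real (Suc n) - 1 / 2) / (?x - 1 / 2)"
    proof -
      have "?x + real n - 1 / 2 \<noteq> 0" using assms by linarith
      moreover have eq: "?x + real (Suc n) - 1 / 2 = ?x + real n + 1 / 2" by simp
      moreover have "(a / c) * (e / a) = e / c" if "a \<noteq> 0" for a c e :: real
        using that by simp
      ultimately show ?thesis unfolding eq by blast
    qed
    finally show ?case .
  qed
  have nz: "Gamma (z + 1 / 2) \<noteq> 0"
  proof
    assume "Gamma (z + 1 / 2) = 0"
    then obtain n where "z + 1 / 2 = of_int n" "n \<le> 0"
      unfolding Gamma_eq_zero_iff by (rule nonpos_Ints_cases)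
    from arg_cong[OF this(1), of Re] this(2) assms show False by simp
  qed
  have lim1: "(\<lambda>n. (norm (Gamma_series z n / Gamma_series (z + 1 / 2) n))\<^sup>2)
      \<longlonglongrightarrow> (norm (Gamma z / Gamma (z + 1 / 2)))\<^sup>2"
    by (intro tendsto_power tendsto_norm tendsto_divide Gamma_series_LIMSEQ nz)
  \<comment> \<open>The bound from \<open>prod\<close> grows linearly in \<open>n\<close>. The
    factors \<open>n powr z\<close> and \<open>n powr (z + 1/2)\<close> of the two Gamma series
    contribute \<open>1 / n\<close> after squaring, so the product has a finite limit.\<close>
  have lim2: "(\<lambda>n. (?x + real (Suc n) - 1 / 2) / (?x - 1 / 2) / real n) \<longlonglongrightarrow> 1 / (?x - 1 / 2)"
  proof -
    have "(\<lambda>n. ((?x + 1 / 2) / real n + 1) / (?x - 1 / 2)) \<longlonglongrightarrow> (0 + 1) / (?x - 1 / 2)"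
      using assms by (intro tendsto_intros real_tendsto_divide_at_top[OF tendsto_const] filterlim_real_sequentially) auto
    moreover have "eventually (\<lambda>n. ((?x + 1 / 2) / real n + 1) / (?x - 1 / 2)
        = (?x + real (Suc n) - 1 / 2) / (?x - 1 / 2) / real n) sequentially"
      using eventually_gt_at_top[of 0] by eventually_elim (use assms in \<open>simp add: field_simps\<close>)
    ultimately show ?thesis
      by (simp add: tendsto_cong)
  qed
  have bound: "eventually (\<lambda>n. (norm (Gamma_series z n / Gamma_series (z + 1 / 2) n))\<^sup>2
      \<le> (?x + real (Suc n) - 1 / 2) / (?x - 1 / 2) / real n) sequentially"
    using eventually_gt_at_top[of 0]
  proof eventually_elim
    case (elim n)
    have "Gamma_series z n / Gamma_series (z + 1 / 2) n =
        exp (z * of_real (ln (real n))) / exp ((z + 1 / 2) * of_real (ln (real n))) *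
        (pochhammer (z + 1 / 2) (Suc n) / pochhammer z (Suc n))"
      by (simp add: Gamma_series_def)
    also have "exp (z * of_real (ln (real n))) / exp ((z + 1 / 2) * of_real (ln (real n)))
        = complex_of_real (exp (- ln (real n) / 2))"
      by (simp flip: exp_diff exp_of_real add: algebra_simps)
    finally have "(norm (Gamma_series z n / Gamma_series (z + 1 / 2) n))\<^sup>2 =
       (exp (- ln (real n) / 2))\<^sup>2 * (norm (pochhammer (z + 1 / 2) (Suc n) / pochhammer z (Suc n)))\<^sup>2"
      by (simp add: norm_mult norm_divide power_mult_distrib power_divide)
    also have "(exp (- ln (real n) / 2))\<^sup>2 = exp (- ln (real n))"
      by (simp flip: exp_double)
    also have "\<dots> = 1 / real n"
      using elim by (simp add: exp_minus inverse_eq_divide)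
    also have "1 / real n * (norm (pochhammer (z + 1 / 2) (Suc n) / pochhammer z (Suc n)))\<^sup>2
       \<le> 1 / real n * ((?x + real (Suc n) - 1 / 2) / (?x - 1 / 2))"
      by (intro mult_left_mono prod) auto
    finally show ?case by (simp add: mult.commute)
  qed
  show ?thesis
    by (rule tendsto_le[OF _ lim2 lim1 bound]) simp
qed

section \<open>Upper and lower bounds for the Dirichlet series\<close>

lemma norm_of_nat_powr_neg:
  "norm (of_nat (Suc n) powr (- s) :: complex) = real (Suc n) powr (- Re s)"
  using norm_powr_real_powr[of "of_nat (Suc n)" "- s"] by (simp del: of_nat_Suc)

lemma summable_Suc_powr_neg:
  assumes "(a::real) > 1"
  shows "summable (\<lambda>n. real (Suc n) powr (- a))"
  using assms summable_real_powr_iff[of "- a"] by (subst summable_Suc_iff) auto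

lemma norm_zeta_series_le:
  assumes "1 < a" "a \<le> Re s"
  shows "norm (zeta_series s) \<le> (\<Sum>n. real (Suc n) powr (- a))"
proof -
  have le: "norm (of_nat (Suc n) powr (- s) :: complex) \<le> real (Suc n) powr (- a)" for n
    unfolding norm_of_nat_powr_neg using assms by (intro powr_mono) auto
  show ?thesis
    unfolding zeta_series_def
    by (intro norm_suminf_le le summable_Suc_powr_neg assms)
qed

lemma norm_zeta_series_ge:
  assumes "2 \<le> Re s"
  shows "norm (zeta_series s) \<ge> 1 / 4"
proof -
  let ?f = "\<lambda>n. of_nat (Suc n) powr (- s) :: complex"
  \<comment> \<open>\<open>?g n\<close> majorizes the term of index \<open>n + 2\<close>. The first
    value keeps \<open>2 powr -2\<close> as it is; the telescoping bound \<open>1/2\<close> in its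
    place would give the total \<open>1\<close> and no positive lower bound.\<close>
  let ?g = "\<lambda>n. (if n = 0 then 1 / 4 else 1 / (real n + 1) - 1 / (real n + 2)) :: real"
  have tel: "(\<lambda>n. 1 / (real (Suc n) + 1) - 1 / (real (Suc n) + 2)) sums (1 / 2)"
  proof -
    have "(\<lambda>n. 1 / (real n + 2)) \<longlonglongrightarrow> 0"
      using LIMSEQ_ignore_initial_segment[OF lim_1_over_n, of 2] by (simp add: add_ac)
    from telescope_sums'[OF this] show ?thesis
      by (simp add: algebra_simps)
  qed
  have gsum: "?g sums (3 / 4)"
    using tel sums_Suc_iff[of ?g "1 / 2"] by simp
  have le: "norm (?f (Suc n)) \<le> ?g n" for n
  proof -
    have "norm (?f (Suc n)) = real (Suc (Suc n)) powr (- Re s)"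
      by (rule norm_of_nat_powr_neg)
    also have "\<dots> \<le> real (Suc (Suc n)) powr (- 2)"
      using assms by (intro powr_mono) auto
    also have "\<dots> = 1 / (real n + 2)\<^sup>2"
      by (simp add: powr_minus powr_numeral inverse_eq_divide add_ac)
    also have "\<dots> \<le> ?g n"
    proof (cases "n = 0")
      case False
      have "1 / (real n + 2)\<^sup>2 \<le> 1 / ((real n + 1) * (real n + 2))"
        unfolding power2_eq_square by (intro divide_left_mono mult_mono) auto
      also have "\<dots> = 1 / (real n + 1) - 1 / (real n + 2)"
        by (simp add: diff_frac_eq)
      finally show ?thesis using False by simp
    qed simp
    finally show ?thesis .
  qed
  have sf: "summable (\<lambda>n. ?f (Suc n))"
    by (rule summable_comparison_test'[OF sums_summable[OF gsum], of 0]) (rule le)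
  have "zeta_series s = ?f 0 + (\<Sum>n. ?f (Suc n))"
    unfolding zeta_series_def using suminf_split_head[of ?f] sf summable_Suc_iff[of ?f] by (simp del: of_nat_Suc)
  then have eq: "zeta_series s = 1 + (\<Sum>n. ?f (Suc n))" by simp
  have "norm (\<Sum>n. ?f (Suc n)) \<le> 3 / 4"
    using norm_suminf_le[OF le sums_summable[OF gsum]] gsum by (simp add: sums_iff)
  then show ?thesis
    unfolding eq using norm_diff_ineq[of 1 "\<Sum>n. ?f (Suc n)"] by simp
qed

text \<open>The constant collects \<open>sqrt pi\<close> from the powers of pi,
  \<open>sqrt 2\<close> from the Gamma quotient at \<open>s / 2\<close>, the zeta series at
  \<open>a\<close>, and \<open>4\<close> because \<open>1 + s\<close> has real part at least 2. The
  decay in \<open>Re s\<close> that remains is what makes the factors of large coroots at most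
  1.\<close>

lemma completed_zeta_quotient_bound:
  assumes "(a::real) > 1"
  obtains K where "K > 0"
    "\<And>s. Re s \<ge> a \<Longrightarrow> norm (completed_zeta s / completed_zeta (1 + s)) \<le> K / sqrt (Re s - 1)"
proof
  let ?Z = "\<Sum>n. real (Suc n) powr (- a)"
  let ?K = "sqrt pi * sqrt 2 * (?Z * 4)"
  have "?Z > 0"
    by (intro suminf_pos summable_Suc_powr_neg assms) auto
  then show "?K > 0" by simp
  fix s assume s: "Re s \<ge> a"
  \<comment> \<open>Both arguments lie in the half-plane of absolute convergence, so the analytic
    continuation is never consulted.\<close>
  have zeta: "riemann_zeta s = zeta_series s" "riemann_zeta (1 + s) = zeta_series (1 + s)"
    using s assms by (auto simp: riemann_zeta_def)
  have "completed_zeta s / completed_zeta (1 + s) =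
      (of_real pi powr (- s / 2) / of_real pi powr (- (1 + s) / 2)) *
      (Gamma (s / 2) / Gamma (s / 2 + 1 / 2)) * (zeta_series s / zeta_series (1 + s))"
    by (simp add: completed_zeta_def zeta add_divide_distrib add_ac)
  then have "norm (completed_zeta s / completed_zeta (1 + s)) =
      norm (of_real pi powr (- s / 2) / of_real pi powr (- (1 + s) / 2) :: complex) *
      norm (Gamma (s / 2) / Gamma (s / 2 + 1 / 2)) * norm (zeta_series s / zeta_series (1 + s))"
    by (simp only: norm_mult)
  also have "\<dots> \<le> sqrt pi * (sqrt 2 / sqrt (Re s - 1)) * (?Z * 4)"
  proof (intro mult_mono)
    have "norm (of_real pi powr (- s / 2) / of_real pi powr (- (1 + s) / 2) :: complex)
       = pi powr (- Re s / 2) / pi powr (- (1 + Re s) / 2)"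
      by (simp add: norm_divide norm_powr_real_powr)
    also have "\<dots> = pi powr (1 / 2)"
      by (simp flip: powr_diff add: field_simps)
    finally show "norm (of_real pi powr (- s / 2) / of_real pi powr (- (1 + s) / 2) :: complex) \<le> sqrt pi"
      by (simp add: powr_half_sqrt)
    have "(norm (Gamma (s / 2) / Gamma (s / 2 + 1 / 2)))\<^sup>2 \<le> 1 / (Re (s / 2) - 1 / 2)"
      using s assms by (intro norm_Gamma_half_quotient_le) auto
    also have "\<dots> = 2 / (Re s - 1)"
      using s assms by (simp add: field_simps)
    finally have "sqrt ((norm (Gamma (s / 2) / Gamma (s / 2 + 1 / 2)))\<^sup>2) \<le> sqrt (2 / (Re s - 1))"
      by (rule real_sqrt_le_mono)
    then show "norm (Gamma (s / 2) / Gamma (s / 2 + 1 / 2)) \<le> sqrt 2 / sqrt (Re s - 1)"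
      by (simp add: real_sqrt_divide)
    have "norm (zeta_series s / zeta_series (1 + s)) \<le> ?Z / (1 / 4)"
      unfolding norm_divide using s assms \<open>?Z > 0\<close>
      by (intro frac_le norm_zeta_series_le norm_zeta_series_ge) auto
    then show "norm (zeta_series s / zeta_series (1 + s)) \<le> ?Z * 4" by simp
  qed (use s assms in auto)
  finally show "norm (completed_zeta s / completed_zeta (1 + s)) \<le> ?K / sqrt (Re s - 1)"
    by (simp add: field_simps)
qed

section \<open>Weight vectors and sl2-strings\<close>

text \<open>At a point \<open>x\<close> where \<open>wt b\<close> and \<open>\<beta>\<close> differ,
  \<open>T x - wt b x\<close> removes the \<open>b\<close>-component and multiplies \<open>d\<close>
  by a nonzero scalar, so \<open>d\<close> already lies in the span of the other vectors.\<close>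

lemma span_weight_vectors_other_weight_zero:
  fixes T :: "'h \<Rightarrow> 'a::real_vector \<Rightarrow> 'a"
  assumes lin: "\<And>x. linear (T x)"
    and "finite F" and "\<forall>b\<in>F. wt b \<noteq> \<beta> \<and> (\<forall>x. T x b = wt b x *\<^sub>R b)"
    and "d \<in> span F" and "\<forall>x. T x d = \<beta> x *\<^sub>R d"
  shows "d = 0"
  using assms(2-)
proof (induction F arbitrary: d rule: finite_induct)
  case empty
  then show ?case by simp
next
  case (insert b F)
  have stable: "T x y - k *\<^sub>R y \<in> span F" if "y \<in> span F" for x y k
  proof -
    have "T x y \<in> span (T x ` F)"
      using that lin linear_span_image by blast
    also have "span (T x ` F) \<subseteq> span F"
      using insert.prems(1) by (intro span_minimal) (auto intro: span_scale span_base)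
    finally show ?thesis using that by (intro span_diff span_scale)
  qed
  from insert.prems(2) obtain k where k: "d - k *\<^sub>R b \<in> span F"
    by (auto simp: span_insert)
  from insert.prems(1) obtain x where x: "wt b x \<noteq> \<beta> x" by (auto simp: fun_eq_iff)
  have "T x (d - k *\<^sub>R b) - wt b x *\<^sub>R (d - k *\<^sub>R b) = (\<beta> x - wt b x) *\<^sub>R d"
    using insert.prems(1,3) by (simp add: linear_diff[OF lin] linear_scale[OF lin] algebra_simps)
  with stable[OF k, of x "wt b x"] have "(\<beta> x - wt b x) *\<^sub>R d \<in> span F" by simp
  then have "(1 / (\<beta> x - wt b x)) *\<^sub>R (\<beta> x - wt b x) *\<^sub>R d \<in> span F"
    by (rule span_scale)
  with x have "d \<in> span F" by simp
  then show ?case using insert.prems by (intro insert.IH) auto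
qed

text \<open>Split \<open>y\<close> into generators of weight \<open>\<beta>\<close> and the rest;
  the second part again has weight \<open>\<beta>\<close>, hence vanishes. \<open>P\<close> carries
  a label for each generator. A weight is chosen for each \<open>b\<close> because a vanishing
  generator has every weight.\<close>

lemma weight_vector_in_span_same_weight:
  fixes T :: "'h \<Rightarrow> 'a::real_vector \<Rightarrow> 'a"
  assumes lin: "\<And>x. linear (T x)"
    and B: "\<And>b. b \<in> B \<Longrightarrow> \<exists>\<mu>. P \<mu> b \<and> (\<forall>x. T x b = \<mu> x *\<^sub>R b)"
    and y: "y \<in> span B" and wt: "\<And>x. T x y = \<beta> x *\<^sub>R y"
  shows "y \<in> span {b \<in> B. P \<beta> b \<and> (\<forall>x. T x b = \<beta> x *\<^sub>R b)}"
proof -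
  obtain w where w: "\<And>b. b \<in> B \<Longrightarrow> P (w b) b \<and> (\<forall>x. T x b = w b x *\<^sub>R b)"
    using B by metis
  let ?S = "{b \<in> B. w b = \<beta>}" and ?N = "{b \<in> B. w b \<noteq> \<beta>}"
  have "B = ?S \<union> ?N" by auto
  with y have "y \<in> span (?S \<union> ?N)" by simp
  then obtain p q where pq: "y = p + q" "p \<in> span ?S" "q \<in> span ?N"
    by (auto simp: span_Un)
  have sub: "subspace {p. \<forall>x. T x p = \<beta> x *\<^sub>R p}"
    by (auto simp: subspace_def linear_add[OF lin] linear_scale[OF lin] linear_0[OF lin] algebra_simps)
  have "span ?S \<subseteq> {p. \<forall>x. T x p = \<beta> x *\<^sub>R p}"
    using w by (intro span_minimal sub) auto
  with pq(2) have "T x p = \<beta> x *\<^sub>R p" for x by auto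
  with wt have q: "\<forall>x. T x q = \<beta> x *\<^sub>R q"
    unfolding pq(1) by (auto simp: linear_add[OF lin] algebra_simps)
  from pq(3) obtain F where F: "finite F" "F \<subseteq> ?N" "q \<in> span F"
    by (auto simp: span_explicit intro!: span_sum span_scale span_base)
  have "q = 0"
    by (rule span_weight_vectors_other_weight_zero[OF lin F(1) _ F(3) q, where wt = w]) (use F(2) w in auto)
  with pq have "y \<in> span ?S" by simp
  also have "span ?S \<subseteq> span {b \<in> B. P \<beta> b \<and> (\<forall>x. T x b = \<beta> x *\<^sub>R b)}"
    using w by (intro span_mono) auto
  finally show ?thesis .
qed

text \<open>In \<open>E (F^(k+1) z) = (k + 1) (p - k) F^k z\<close> the scalar is nonzero for
  \<open>k < p\<close>, so a vanishing power would make the preceding one vanish.\<close>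

lemma sl2_string_nonzero:
  fixes E F Ht :: "'a::real_vector \<Rightarrow> 'a"
  assumes lin: "linear E" "linear F" "linear Ht"
    and EF: "\<And>v. E (F v) = F (E v) + Ht v"
    and HF: "\<And>v. Ht (F v) = F (Ht v) - 2 *\<^sub>R F v"
    and z: "z \<noteq> 0" "E z = 0" "Ht z = real p *\<^sub>R z" and "j \<le> p"
  shows "(F ^^ j) z \<noteq> 0"
  using \<open>j \<le> p\<close>
proof (induction j)
  case 0
  then show ?case using z by simp
next
  case (Suc j)
  have H: "Ht ((F ^^ k) z) = (real p - 2 * real k) *\<^sub>R (F ^^ k) z" for k
  proof (induction k)
    case (Suc k)
    have "Ht ((F ^^ Suc k) z) = F (Ht ((F ^^ k) z)) - 2 *\<^sub>R F ((F ^^ k) z)"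
      by (simp add: HF)
    also have "\<dots> = (real p - 2 * real (Suc k)) *\<^sub>R (F ^^ Suc k) z"
      unfolding Suc linear_scale[OF lin(2)] by (simp add: algebra_simps)
    finally show ?case .
  qed (simp add: z)
  have "E ((F ^^ Suc k) z) = (real (Suc k) * (real p - real k)) *\<^sub>R (F ^^ k) z" for k
  proof (induction k)
    case 0
    then show ?case by (simp add: EF z linear_0[OF lin(2)])
  next
    case (Suc k)
    have "E ((F ^^ Suc (Suc k)) z) = F (E ((F ^^ Suc k) z)) + Ht ((F ^^ Suc k) z)"
      by (simp add: EF)
    also have "\<dots> = (real (Suc k) * (real p - real k)) *\<^sub>R (F ^^ Suc k) z
        + (real p - 2 * real (Suc k)) *\<^sub>R (F ^^ Suc k) z"
      unfolding Suc H linear_scale[OF lin(2)] by simp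
    also have "\<dots> = (real (Suc (Suc k)) * (real p - real (Suc k))) *\<^sub>R (F ^^ Suc k) z"
      unfolding scaleR_left_distrib[symmetric] by (simp add: algebra_simps)
    finally show ?case .
  qed
  from this[of j] have *: "E ((F ^^ Suc j) z) = (real (Suc j) * (real p - real j)) *\<^sub>R (F ^^ j) z" .
  show ?case
  proof
    assume "(F ^^ Suc j) z = 0"
    with * have "(real (Suc j) * (real p - real j)) *\<^sub>R (F ^^ j) z = 0"
      by (simp add: linear_0[OF lin(1)])
    with Suc show False by auto
  qed
qed

lemma linear_funpow:
  fixes f :: "'a::real_vector \<Rightarrow> 'a"
  assumes "linear f"
  shows "linear (f ^^ n)"
proof (induction n)
  case (Suc n)
  show ?case unfolding funpow.simps by (rule linear_compose[OF Suc assms])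
qed (simp add: linear_iff)

text \<open>By the Leibniz rule one \<open>d\<close> falls on either argument, lowering
  \<open>m\<close> or \<open>n\<close>; induction on \<open>m + n\<close> replaces the binomial
  expansion.\<close>

lemma derivation_locally_nilpotent_bracket:
  fixes d :: "'a::real_vector \<Rightarrow> 'a"
  assumes d: "linear d" and leib: "\<And>x y. d (b x y) = b (d x) y + b x (d y)"
    and b0: "\<And>y. b 0 y = 0" "\<And>x. b x 0 = 0"
    and "(d ^^ m) x = 0" "(d ^^ n) y = 0"
  shows "(d ^^ (m + n)) (b x y) = 0"
  using assms(5,6)
proof (induction "m + n" arbitrary: m n x y)
  case 0
  then show ?case by (simp add: b0)
next
  case (Suc s)
  have z: "(d ^^ k) 0 = 0" for k by (induction k) (simp_all add: linear_0[OF d])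
  note lin = linear_funpow[OF d]
  show ?case
  proof (cases "m = 0 \<or> n = 0")
    case True
    then show ?thesis using Suc.prems by (auto simp: b0 z)
  next
    case False
    then obtain m' n' where mn: "m = Suc m'" "n = Suc n'" by (meson not0_implies_Suc)
    have "(d ^^ (m' + n)) (b (d x) y) = 0"
      using Suc.prems Suc.hyps(2) mn by (intro Suc.hyps(1)) (auto simp: funpow_swap1)
    moreover have "(d ^^ (m + n')) (b x (d y)) = 0"
      using Suc.prems Suc.hyps(2) mn by (intro Suc.hyps(1)) (auto simp: funpow_swap1)
    moreover have "(d ^^ (m + n)) (b x y) = (d ^^ (m' + n)) (b (d x) y) + (d ^^ (m + n')) (b x (d y))"
    proof -
      have "(d ^^ (m + n)) (b x y) = (d ^^ (m' + n)) (d (b x y))"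
        using mn by (simp add: funpow_swap1)
      moreover have "m' + n = m + n'" using mn by simp
      ultimately show ?thesis by (simp only: leib linear_add[OF lin])
    qed
    ultimately show ?thesis by simp
  qed
qed

section \<open>Roots of the Kac--Moody algebra\<close>

definition root_comb ::
  "('i::finite, 'h::euclidean_space, 'g, 'v) kac_moody_datum \<Rightarrow> ('i \<Rightarrow> real) \<Rightarrow> 'h \<Rightarrow> real" where
  "root_comb D c x = (\<Sum>i\<in>UNIV. c i * sroot D i x)"

lemma root_comb_add: "root_comb D (\<lambda>i. c i + d i) x = root_comb D c x + root_comb D d x"
  by (simp add: root_comb_def algebra_simps sum.distrib)

lemma root_comb_scale: "root_comb D (\<lambda>i. k * c i) x = k * root_comb D c x"
  by (simp add: root_comb_def sum_distrib_left mult_ac)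

lemma root_comb_zero [simp]: "root_comb D (\<lambda>_. 0) x = 0"
  by (simp add: root_comb_def)

lemma root_comb_delta: "root_comb D (\<lambda>j. if j = i then k else 0) x = k * sroot D i x"
  by (simp add: root_comb_def if_distrib[of "\<lambda>c. c * _"] cong: if_cong)

lemma root_comb_Suc:
  "root_comb D (\<lambda>k. real ((n(i := Suc (n i))) k)) x = root_comb D (\<lambda>k. real (n k)) x + sroot D i x"
proof -
  have "root_comb D (\<lambda>k. real ((n(i := Suc (n i))) k)) x
      = root_comb D (\<lambda>k. real (n k) + (if k = i then 1 else 0)) x"
    by (rule arg_cong[where f = "\<lambda>c. root_comb D c x"]) auto
  then show ?thesis by (simp add: root_comb_add root_comb_delta)
qed

text \<open>Iterated brackets of raising generators, stored with their multidegree: a word may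
  vanish, and the zero vector does not determine a weight.\<close>

inductive_set e_words ::
  "('i::finite, 'h::euclidean_space, 'g::real_vector, 'v) kac_moody_datum \<Rightarrow> (('i \<Rightarrow> nat) \<times> 'g) set"
  for D where
  gen: "((\<lambda>_. 0)(i := Suc 0), chev_e D i) \<in> e_words D"
| step: "(n, x) \<in> e_words D \<Longrightarrow> (n(i := Suc (n i)), bracket D (chev_e D i) x) \<in> e_words D"

text \<open>The Chevalley involution, seen as a change of the datum: it exchanges raising and lowering
  generators, so that every statement about the former yields one about the latter.\<close>

definition chevalley_swap ::
  "('i::finite, 'h, 'g::real_vector, 'v) kac_moody_datum \<Rightarrow> ('i, 'h, 'g, 'v) kac_moody_datum" where
  "chevalley_swap D = D\<lparr>cart := \<lambda>x. - cart D x, chev_e := chev_f D, chev_f := chev_e D\<rparr>"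

lemma chevalley_swap_simps [simp]:
  "cartan (chevalley_swap D) = cartan D" "sroot (chevalley_swap D) = sroot D"
  "scoroot (chevalley_swap D) = scoroot D" "bracket (chevalley_swap D) = bracket D"
  "cart (chevalley_swap D) = (\<lambda>x. - cart D x)" "chev_e (chevalley_swap D) = chev_f D"
  "chev_f (chevalley_swap D) = chev_e D"
  by (simp_all add: chevalley_swap_def)

lemma chevalley_swap_swap [simp]: "chevalley_swap (chevalley_swap D) = D"
  by (simp add: chevalley_swap_def)

lemma root_comb_chevalley_swap [simp]: "root_comb (chevalley_swap D) = root_comb D"
  by (simp add: root_comb_def fun_eq_iff)

lemma chev_e_in_e_words: "chev_e D i \<in> snd ` e_words D"
  using e_words.gen[of i D] by (metis image_eqI snd_conv)

lemma bracket_chev_e_in_e_words: "x \<in> snd ` e_words D \<Longrightarrow> bracket D (chev_e D i) x \<in> snd ` e_words D"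
  by (auto intro: e_words.step image_eqI[rotated])

locale km_algebra =
  fixes D :: "('i::finite, 'h::euclidean_space, 'g::real_vector, 'v) kac_moody_datum"
  assumes gcm: "generalized_cartan_matrix (cartan D)"
    and real: "realization D"
    and km: "kac_moody_algebra D"
begin

abbreviation br where "br \<equiv> bracket D"
abbreviation \<alpha> where "\<alpha> \<equiv> sroot D"
abbreviation \<alpha>v where "\<alpha>v \<equiv> scoroot D"
abbreviation nat_comb :: "('i \<Rightarrow> nat) \<Rightarrow> 'h \<Rightarrow> real" where
  "nat_comb n \<equiv> root_comb D (\<lambda>k. real (n k))"

lemma linear_sroot: "linear (\<alpha> i)"
  using real by (auto simp: realization_def)

lemma linear_root_comb: "linear (root_comb D c)"
  by (simp add: linear_iff root_comb_def linear_add[OF linear_sroot] linear_scale[OF linear_sroot]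
      sum.distrib sum_distrib_left algebra_simps)

lemma root_comb_inject: "root_comb D c = root_comb D d \<longleftrightarrow> c = d"
proof
  assume eq: "root_comb D c = root_comb D d"
  have "\<forall>x. (\<Sum>i\<in>UNIV. (c i - d i) * \<alpha> i x) = 0"
    using fun_cong[OF eq] by (simp add: root_comb_def algebra_simps sum_subtractf)
  with real have "\<forall>i. c i - d i = 0"
    unfolding realization_def by fast
  then show "c = d" by (auto simp: fun_eq_iff)
qed simp

lemma sroot_scoroot: "\<alpha> j (\<alpha>v i) = of_int (cartan D $ i $ j)"
  using real by (auto simp: realization_def)

lemma sroot_scoroot_same [simp]: "\<alpha> i (\<alpha>v i) = 2"
  using gcm by (simp add: sroot_scoroot generalized_cartan_matrix_def)

lemma scoroot_nonzero: "\<alpha>v i \<noteq> 0"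
  using sroot_scoroot_same[of i] linear_0[OF linear_sroot[of i]] by force

lemma nat_comb_scoroot_int: "nat_comb n (\<alpha>v i) \<in> \<int>"
  by (auto simp: root_comb_def sroot_scoroot)

lemma linear_br: "linear (br x)" and linear_br_left: "linear (\<lambda>x. br x y)"
  using km by (auto simp: kac_moody_algebra_def lie_algebra_def)

lemmas br_simps = linear_add[OF linear_br] linear_scale[OF linear_br] linear_0[OF linear_br]
  linear_diff[OF linear_br] linear_neg[OF linear_br]
  linear_add[OF linear_br_left] linear_scale[OF linear_br_left] linear_0[OF linear_br_left]
  linear_diff[OF linear_br_left] linear_neg[OF linear_br_left]

lemma br_same [simp]: "br x x = 0"
  using km by (auto simp: kac_moody_algebra_def lie_algebra_def)

lemma br_anti: "br x y = - br y x"
  using br_same[of "x + y"] unfolding br_simps by (simp add: eq_neg_iff_add_eq_0 add.commute)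

lemma br_jacobi: "br x (br y z) = br (br x y) z + br y (br x z)"
proof -
  have "br x (br y z) + br y (br z x) + br z (br x y) = 0"
    using km by (auto simp: kac_moody_algebra_def lie_algebra_def)
  then have "br x (br y z) = - br z (br x y) + br y (- br z x)"
    by (simp add: br_simps eq_neg_iff_add_eq_0 algebra_simps)
  also have "\<dots> = br (br x y) z + br y (br x z)"
    using br_anti[of "br x y" z] br_anti[of x z] by simp
  finally show ?thesis .
qed

lemma br_cart_cart [simp]: "br (cart D x) (cart D y) = 0"
  and br_cart_e [simp]: "br (cart D x) (chev_e D i) = \<alpha> i x *\<^sub>R chev_e D i"
  and br_cart_f [simp]: "br (cart D x) (chev_f D i) = - (\<alpha> i x *\<^sub>R chev_f D i)"
  and br_e_f: "br (chev_e D i) (chev_f D j) = (if i = j then cart D (\<alpha>v i) else 0)"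
  and linear_cart: "linear (cart D)" and inj_cart: "inj (cart D)"
  using km by (simp_all add: kac_moody_algebra_def)

lemma br_e_cart: "br (chev_e D i) (cart D x) = - (\<alpha> i x *\<^sub>R chev_e D i)"
  using br_anti[of "chev_e D i" "cart D x"] by simp

lemma br_f_cart: "br (chev_f D i) (cart D x) = \<alpha> i x *\<^sub>R chev_f D i"
  using br_anti[of "chev_f D i" "cart D x"] by simp

lemma br_f_e: "br (chev_f D i) (chev_e D j) = (if i = j then - cart D (\<alpha>v i) else 0)"
  using br_anti[of "chev_f D i" "chev_e D j"] by (simp add: br_e_f)

lemma serre_e: "i \<noteq> j \<Longrightarrow> (br (chev_e D i) ^^ nat (1 - cartan D $ i $ j)) (chev_e D j) = 0"
  using km by (auto simp: kac_moody_algebra_def)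

text \<open>Negating \<open>cart\<close> is forced by \<open>[f_i, e_i] = - h_i\<close>. It gives
  \<open>f_i\<close> the weight \<open>\<alpha> i\<close> in the swapped datum and keeps the range
  of \<open>cart\<close>, so the clauses on generation and ideals carry over.\<close>

lemma km_algebra_swap: "km_algebra (chevalley_swap D)"
proof
  show "generalized_cartan_matrix (cartan (chevalley_swap D))" using gcm by simp
  show "realization (chevalley_swap D)" using real by (simp add: realization_def)
  have "range (\<lambda>x. - cart D x) = range (cart D)"
  proof safe
    fix x
    show "- cart D x \<in> range (cart D)" by (metis linear_neg[OF linear_cart] rangeI)
    have "cart D x = - cart D (- x)" by (simp add: linear_neg[OF linear_cart])
    then show "cart D x \<in> range (\<lambda>x. - cart D x)" by blast
  qed
  moreover have "inj (\<lambda>x. - cart D x)" using inj_cart by (auto simp: inj_def)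
  moreover have "linear (\<lambda>x. - cart D x)" using linear_cart by (rule linear_compose_neg)
  ultimately show "kac_moody_algebra (chevalley_swap D)"
    using km unfolding kac_moody_algebra_def chevalley_swap_simps
    by (simp add: br_simps br_f_e Un_ac)
qed

lemma lie_generated_induct [case_names cart e f zero add scale br]:
  assumes gen: "\<And>x. P (cart D x)" "\<And>i. P (chev_e D i)" "\<And>i. P (chev_f D i)"
    and sub: "P 0" "\<And>x y. P x \<Longrightarrow> P y \<Longrightarrow> P (x + y)" "\<And>c x. P x \<Longrightarrow> P (c *\<^sub>R x)"
    and br: "\<And>x y. P x \<Longrightarrow> P y \<Longrightarrow> P (br x y)"
  shows "P x"
proof -
  have "subspace {x. P x}" using sub by (auto simp: subspace_def)
  moreover have "range (cart D) \<union> range (chev_e D) \<union> range (chev_f D) \<subseteq> {x. P x}"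
    using gen by auto
  ultimately have "{x. P x} = UNIV"
    using km br unfolding kac_moody_algebra_def by simp
  then show ?thesis by auto
qed

text \<open>By the Leibniz rule the elements killed by a power of \<open>ad e_i\<close> form a
  subalgebra. It contains the generators: \<open>e_j\<close> by the Serre relations, while
  \<open>f_i\<close> goes to \<open>h_i\<close>, then to a multiple of \<open>e_i\<close>, then to
  zero.\<close>

lemma ad_e_locally_nilpotent: "\<exists>n. (br (chev_e D i) ^^ n) x = 0"
proof (induction x rule: lie_generated_induct)
  let ?d = "br (chev_e D i)"
  have z: "(?d ^^ k) 0 = 0" for k by (induction k) (simp_all add: br_simps)
  have more: "(?d ^^ (m + n)) x = 0" if "(?d ^^ n) x = 0" for m n x
    using that by (simp add: funpow_add z)
  note lin = linear_funpow[OF linear_br]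
  {
    case (cart x)
    show ?case by (rule exI[of _ 2]) (simp add: numeral_2_eq_2 br_e_cart br_simps)
  next
    case (e j)
    show ?case
    proof (cases "i = j")
      case True
      then show ?thesis by (intro exI[of _ 1]) simp
    qed (use serre_e in blast)
  next
    case (f j)
    show ?case by (rule exI[of _ 3]) (simp add: numeral_3_eq_3 br_e_f br_e_cart br_simps)
  next
    case zero
    show ?case by (rule exI[of _ 0]) simp
  next
    case (add x y)
    then obtain m n where "(?d ^^ m) x = 0" "(?d ^^ n) y = 0" by auto
    then have "(?d ^^ (n + m)) (x + y) = 0"
      using more[of m x n] more[of n y m] by (simp add: linear_add[OF lin] add.commute)
    then show ?case by blast
  next
    case (scale c x)
    then show ?case by (auto simp: linear_scale[OF lin])
  next
    case (br x y)
    then obtain m n where "(?d ^^ m) x = 0" "(?d ^^ n) y = 0" by auto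
    then have "(?d ^^ (m + n)) (br x y) = 0"
      by (intro derivation_locally_nilpotent_bracket) (auto simp: linear_br br_simps br_jacobi[of "chev_e D i"])
    then show ?case by blast
  }
qed

lemma e_word_weight:
  "(n, x) \<in> e_words D \<Longrightarrow> br (cart D h) x = nat_comb n h *\<^sub>R x"
proof (induction rule: e_words.induct)
  case (gen i)
  have "nat_comb ((\<lambda>_. 0)(i := Suc 0)) h = nat_comb (\<lambda>_. 0) h + \<alpha> i h"
    using root_comb_Suc[of D "\<lambda>_. 0" i h] by simp
  then show ?case by (simp add: root_comb_def)
next
  case (step n x i)
  then show ?case
    by (subst br_jacobi) (simp add: root_comb_Suc br_simps algebra_simps del: fun_upd_apply)
qed

lemma f_word_weight:
  assumes "(n, x) \<in> e_words (chevalley_swap D)"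
  shows "br (cart D h) x = - nat_comb n h *\<^sub>R x"
proof -
  interpret sw: km_algebra "chevalley_swap D" by (rule km_algebra_swap)
  show ?thesis
    using sw.e_word_weight[OF assms, of h] by (simp add: br_simps) (metis minus_minus)
qed

text \<open>Moving \<open>f_i\<close> past the leftmost letter \<open>e_j\<close> leaves a
  commutator that is zero or in the Cartan subalgebra and acts on \<open>x\<close> by a scalar; the
  other term is \<open>e_j\<close> applied to the induction hypothesis.\<close>

lemma br_f_e_word: "(n, x) \<in> e_words D \<Longrightarrow> br (chev_f D i) x \<in> span (range (cart D) \<union> snd ` e_words D)"
proof (induction rule: e_words.induct)
  case (gen j)
  show ?case by (auto simp: br_f_e intro: span_base span_neg span_zero)
next
  case (step n x j)
  let ?S = "range (cart D) \<union> snd ` e_words D"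
  have "br (chev_e D j) y \<in> span ?S" if "y \<in> span ?S" for y
  proof -
    have "br (chev_e D j) y \<in> span (br (chev_e D j) ` ?S)"
      using that linear_br linear_span_image by blast
    also have "span (br (chev_e D j) ` ?S) \<subseteq> span ?S"
    proof (rule span_minimal)
      show "br (chev_e D j) ` ?S \<subseteq> span ?S"
      proof (intro image_subsetI, elim UnE imageE)
        fix z h assume "z = cart D h"
        then show "br (chev_e D j) z \<in> span ?S"
          using span_base[of "chev_e D j" ?S] chev_e_in_e_words[of D j] by (simp add: br_e_cart span_neg span_scale)
      next
        fix z p assume "z = snd p" "p \<in> e_words D"
        then show "br (chev_e D j) z \<in> span ?S"
          using bracket_chev_e_in_e_words[of z D j] by (intro span_base) auto
      qed
    qed simp
    finally show ?thesis .
  qed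
  with step.IH have "br (chev_e D j) (br (chev_f D i) x) \<in> span ?S" by blast
  moreover have "br (br (chev_f D i) (chev_e D j)) x \<in> span ?S"
  proof -
    have "x \<in> span ?S" using step.hyps by (force intro: span_base)
    then show ?thesis
      using e_word_weight[OF step.hyps] by (simp add: br_f_e br_simps span_neg span_scale span_zero)
  qed
  ultimately show ?case by (subst br_jacobi) (rule span_add)
qed

text \<open>The spanning half of the triangular decomposition. The span is stable under bracketing
  with each generator, hence by the Jacobi identity with every element, and it contains the
  generators.\<close>

lemma span_words:
  "span (range (cart D) \<union> snd ` e_words D \<union> snd ` e_words (chevalley_swap D)) = UNIV" (is "span ?S = UNIV")
proof -
  interpret sw: km_algebra "chevalley_swap D" by (rule km_algebra_swap)
  have stable: "br x y \<in> span ?S" if "y \<in> span ?S" for x y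
    using that
  proof (induction x arbitrary: y rule: lie_generated_induct)
    case (cart h)
    have "br (cart D h) y \<in> span (br (cart D h) ` ?S)"
      using cart linear_br linear_span_image by blast
    also have "\<dots> \<subseteq> span ?S"
    proof (rule span_minimal)
      show "br (cart D h) ` ?S \<subseteq> span ?S"
      proof (intro image_subsetI)
        fix z assume z: "z \<in> ?S"
        then consider h' where "z = cart D h'" | n where "(n, z) \<in> e_words D"
          | n where "(n, z) \<in> e_words (chevalley_swap D)" by force
        then have "\<exists>c. br (cart D h) z = c *\<^sub>R z"
        proof cases
          case 1
          then show ?thesis by (intro exI[of _ 0]) simp
        qed (blast dest: e_word_weight f_word_weight)+
        then obtain c where "br (cart D h) z = c *\<^sub>R z" ..
        with z show "br (cart D h) z \<in> span ?S" by (simp only: span_scale span_base)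
      qed
    qed simp
    finally show ?case .
  next
    case (e i)
    have "br (chev_e D i) y \<in> span (br (chev_e D i) ` ?S)"
      using e linear_br linear_span_image by blast
    also have "\<dots> \<subseteq> span ?S"
    proof (rule span_minimal)
      show "br (chev_e D i) ` ?S \<subseteq> span ?S"
      proof (intro image_subsetI, elim UnE imageE)
        fix z h assume "z = cart D h"
        then show "br (chev_e D i) z \<in> span ?S"
          using span_base[of "chev_e D i" ?S] chev_e_in_e_words[of D i] by (simp add: br_e_cart span_neg span_scale)
      next
        fix z p assume "z = snd p" "p \<in> e_words D"
        then show "br (chev_e D i) z \<in> span ?S"
          using bracket_chev_e_in_e_words[of z D i] by (intro span_base) auto
      next
        fix z p assume z: "z = snd p" "p \<in> e_words (chevalley_swap D)"
        have "range (\<lambda>x. - cart D x) \<subseteq> range (cart D)"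
          by (auto simp: linear_neg[OF linear_cart, symmetric])
        then have "span (range (\<lambda>x. - cart D x) \<union> snd ` e_words (chevalley_swap D)) \<subseteq> span ?S"
          by (intro span_mono) auto
        then show "br (chev_e D i) z \<in> span ?S"
          using sw.br_f_e_word[of "fst p" "snd p" i] z by auto
      qed
    qed simp
    finally show ?case .
  next
    case (f i)
    have "br (chev_f D i) y \<in> span (br (chev_f D i) ` ?S)"
      using f linear_br linear_span_image by blast
    also have "\<dots> \<subseteq> span ?S"
    proof (rule span_minimal)
      show "br (chev_f D i) ` ?S \<subseteq> span ?S"
      proof (intro image_subsetI, elim UnE imageE)
        fix z h assume "z = cart D h"
        then show "br (chev_f D i) z \<in> span ?S"
          using span_base[of "chev_f D i" ?S] chev_e_in_e_words[of "chevalley_swap D" i] by (simp add: br_f_cart span_scale)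
      next
        fix z p assume "z = snd p" "p \<in> e_words (chevalley_swap D)"
        then show "br (chev_f D i) z \<in> span ?S"
          using bracket_chev_e_in_e_words[of z "chevalley_swap D" i] by (intro span_base) auto
      next
        fix z p assume z: "z = snd p" "p \<in> e_words D"
        have "span (range (cart D) \<union> snd ` e_words D) \<subseteq> span ?S"
          by (intro span_mono) auto
        then show "br (chev_f D i) z \<in> span ?S"
          using br_f_e_word[of "fst p" "snd p" i] z by auto
      qed
    qed simp
    finally show ?case .
  next
    case (br x x')
    have "br (br x x') y = br x (br x' y) - br x' (br x y)"
      by (simp add: br_jacobi[of x])
    with br show ?case by (auto intro: span_diff)
  qed (auto simp: br_simps span_zero intro: span_add span_scale)
  have "x \<in> span ?S" for x
  proof (induction x rule: lie_generated_induct)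
    case (e i)
    show ?case using chev_e_in_e_words[of D i] by (intro span_base) auto
  next
    case (f i)
    show ?case using chev_e_in_e_words[of "chevalley_swap D" i] by (intro span_base) auto
  qed (auto intro: span_base span_zero span_add span_scale stable)
  then show ?thesis by auto
qed

text \<open>A root vector is a combination of words of its own weight, one of them nonzero; Cartan
  elements drop out because a root is not zero. The nonzero word is kept in the conclusion in order
  to exclude proper multiples of simple roots later.\<close>

lemma root_is_word_weight:
  assumes "\<beta> \<in> roots D"
  obtains n x where "x \<noteq> 0" "(n, x) \<in> e_words D" "\<beta> = nat_comb n"
  | n x where "x \<noteq> 0" "(n, x) \<in> e_words (chevalley_swap D)" "\<beta> = (\<lambda>h. - nat_comb n h)"
proof -
  from assms obtain y where y: "\<beta> \<noteq> (\<lambda>_. 0)" "y \<noteq> 0" "\<And>h. br (cart D h) y = \<beta> h *\<^sub>R y"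
    by (auto simp: roots_def)
  let ?S = "range (cart D) \<union> snd ` e_words D \<union> snd ` e_words (chevalley_swap D)"
  let ?P = "\<lambda>\<mu> b. \<mu> = (\<lambda>_. 0) \<or> (\<exists>n. (n, b) \<in> e_words D \<and> \<mu> = nat_comb n) \<or>
    (\<exists>n. (n, b) \<in> e_words (chevalley_swap D) \<and> \<mu> = (\<lambda>h. - nat_comb n h))"
  have "y \<in> span {b \<in> ?S. ?P \<beta> b \<and> (\<forall>h. br (cart D h) b = \<beta> h *\<^sub>R b)}"
  proof (rule weight_vector_in_span_same_weight)
    show "y \<in> span ?S" by (simp add: span_words)
    fix b assume "b \<in> ?S"
    then consider h where "b = cart D h" | n where "(n, b) \<in> e_words D"
      | n where "(n, b) \<in> e_words (chevalley_swap D)" by force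
    then show "\<exists>\<mu>. ?P \<mu> b \<and> (\<forall>x. br (cart D x) b = \<mu> x *\<^sub>R b)"
    proof cases
      case 1
      then show ?thesis by (intro exI[of _ "\<lambda>_. 0"]) simp
    next
      case 2
      then show ?thesis using e_word_weight[OF 2] by (intro exI[of _ "nat_comb n"]) blast
    next
      case 3
      then show ?thesis using f_word_weight[OF 3] by (intro exI[of _ "\<lambda>h. - nat_comb n h"]) blast
    qed
  qed (use y linear_br in auto)
  then have "\<not> {b \<in> ?S. ?P \<beta> b \<and> (\<forall>h. br (cart D h) b = \<beta> h *\<^sub>R b)} \<subseteq> {0}"
    using y(2) span_mono[of _ "{0}"] by auto
  then obtain b where "b \<noteq> 0" "?P \<beta> b" by auto
  with y(1) that show thesis by blast
qed

lemma root_scoroot_int: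
  assumes "\<beta> \<in> roots D"
  shows "\<beta> (\<alpha>v i) \<in> \<int>"
  using assms by (rule root_is_word_weight) (auto simp: nat_comb_scoroot_int)

section \<open>Simple reflections acting on roots\<close>

lemma neg_root_swap: "\<beta> \<in> roots D \<Longrightarrow> (\<lambda>x. - \<beta> x) \<in> roots (chevalley_swap D)"
  by (auto simp: roots_def br_simps fun_eq_iff linear_compose_neg)

text \<open>Raise the root vector to the top of its string, \<open>z = e_i^k y\<close>, on which
  \<open>h_i\<close> has eigenvalue \<open>m + 2 k\<close>. Lowering \<open>m + k\<close> times
  stays in the nonvanishing range and lands in the reflected weight.\<close>

lemma root_subtract_string:
  assumes "\<beta> \<in> roots D" "\<beta> (\<alpha>v i) = real m"
  shows "(\<lambda>x. \<beta> x - real m * \<alpha> i x) \<in> roots D"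
proof -
  from assms obtain y where lin: "linear \<beta>" and nz: "\<beta> \<noteq> (\<lambda>_. 0)" "y \<noteq> 0"
    and wt: "\<And>h. br (cart D h) y = \<beta> h *\<^sub>R y"
    by (auto simp: roots_def)
  let ?e = "br (chev_e D i)" and ?f = "br (chev_f D i)"
  define N where "N = (LEAST n. (?e ^^ n) y = 0)"
  have N: "(?e ^^ N) y = 0"
    unfolding N_def using ad_e_locally_nilpotent by (rule LeastI_ex)
  have "N \<noteq> 0" using N nz by (intro notI) simp
  then obtain k where k: "N = Suc k" by (meson not0_implies_Suc)
  define z where "z = (?e ^^ k) y"
  have "z \<noteq> 0" unfolding z_def using k not_less_Least[of k "\<lambda>n. (?e ^^ n) y = 0"] by (auto simp: N_def)
  have "?e z = 0" using N k by (simp add: z_def)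
  have "br (cart D h) ((?e ^^ l) y) = (\<beta> h + real l * \<alpha> i h) *\<^sub>R (?e ^^ l) y" for l h
  proof (induction l)
    case (Suc l)
    then show ?case by (simp add: br_jacobi[of "cart D h"] br_simps algebra_simps)
  qed (simp add: wt)
  then have wtz: "br (cart D h) z = (\<beta> h + real k * \<alpha> i h) *\<^sub>R z" for h
    by (simp add: z_def)
  have comm_f: "br (cart D h) (?f v) = ?f (br (cart D h) v) - \<alpha> i h *\<^sub>R ?f v" for h v
    by (simp add: br_jacobi[of "cart D h"] br_simps)
  have wtf: "br (cart D h) ((?f ^^ l) z) = (\<beta> h + real k * \<alpha> i h - real l * \<alpha> i h) *\<^sub>R (?f ^^ l) z" for l h
  proof (induction l)
    case (Suc l)
    show ?case unfolding funpow.simps o_apply comm_f Suc br_simps by (simp add: algebra_simps)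
  qed (simp add: wtz)
  have "(?f ^^ (m + k)) z \<noteq> 0"
  proof (rule sl2_string_nonzero[where E = ?e and Ht = "br (cart D (\<alpha>v i))" and p = "m + 2 * k"])
    show "?e (?f v) = ?f (?e v) + br (cart D (\<alpha>v i)) v" for v
      by (simp add: br_jacobi[of "chev_e D i"] br_e_f)
    show "br (cart D (\<alpha>v i)) (?f v) = ?f (br (cart D (\<alpha>v i)) v) - 2 *\<^sub>R ?f v" for v
      by (simp add: br_jacobi[of "cart D (\<alpha>v i)"] br_simps)
    show "br (cart D (\<alpha>v i)) z = real (m + 2 * k) *\<^sub>R z"
      using assms(2) by (simp add: wtz)
  qed (use \<open>z \<noteq> 0\<close> \<open>?e z = 0\<close> linear_br in auto)
  moreover have "br (cart D h) ((?f ^^ (m + k)) z) = (\<beta> h - real m * \<alpha> i h) *\<^sub>R (?f ^^ (m + k)) z" for h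
    using wtf[of h "m + k"] by (simp add: algebra_simps)
  moreover have "linear (\<lambda>x. \<beta> x - real m * \<alpha> i x)"
    using lin linear_compose_scale_right[OF linear_sroot[of i], of "real m"] by (intro linear_compose_sub) auto
  moreover have "(\<lambda>x. \<beta> x - real m * \<alpha> i x) \<noteq> (\<lambda>_. 0)"
  proof
    assume eq: "(\<lambda>x. \<beta> x - real m * \<alpha> i x) = (\<lambda>_. 0)"
    from fun_cong[OF this, of "\<alpha>v i"] assms(2) have "m = 0" by simp
    with eq nz show False by simp
  qed
  ultimately show ?thesis unfolding roots_def by blast
qed

lemma reflected_functional:
  "linear \<beta> \<Longrightarrow> \<beta> \<circ> simple_reflection D i = (\<lambda>x. \<beta> x - \<beta> (\<alpha>v i) * \<alpha> i x)" for \<beta> :: "'h \<Rightarrow> real"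
  by (auto simp: fun_eq_iff simple_reflection_def linear_diff linear_scale)

text \<open>The string argument only lowers. A negative pairing becomes positive after
  \<open>chevalley_swap\<close>, for which the negative of \<open>\<beta>\<close> is a root.\<close>

lemma root_reflect:
  assumes "\<beta> \<in> roots D"
  shows "\<beta> \<circ> simple_reflection D i \<in> roots D"
proof -
  have lin: "linear \<beta>" using assms by (auto simp: roots_def)
  from root_scoroot_int[OF assms, of i] obtain q where q: "\<beta> (\<alpha>v i) = of_int q"
    by (auto elim: Ints_cases)
  show ?thesis
  proof (cases "q \<ge> 0")
    case True
    then have "\<beta> (\<alpha>v i) = real (nat q)" using q by simp
    from root_subtract_string[OF assms this] this show ?thesis
      by (simp add: reflected_functional[OF lin])
  next
    case False
    interpret sw: km_algebra "chevalley_swap D" by (rule km_algebra_swap)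
    have m: "- \<beta> (\<alpha>v i) = real (nat (- q))" using q False by simp
    have "(\<lambda>x. - \<beta> x - real (nat (- q)) * \<alpha> i x) \<in> roots (chevalley_swap D)"
      using sw.root_subtract_string[OF neg_root_swap[OF assms]] m by simp
    from sw.neg_root_swap[OF this]
    have "(\<lambda>x. - (- \<beta> x - real (nat (- q)) * \<alpha> i x)) \<in> roots D" by simp
    also have "(\<lambda>x. - (- \<beta> x - real (nat (- q)) * \<alpha> i x)) = \<beta> \<circ> simple_reflection D i"
      unfolding m[symmetric] reflected_functional[OF lin] by auto
    finally show ?thesis .
  qed
qed

text \<open>A longer word in the single letter \<open>i\<close> contains
  \<open>[e_i, e_i] = 0\<close>. This excludes, as roots, the multiples of a simple root by integers
  above 1.\<close>

lemma e_word_single_letter: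
  "(n, x) \<in> e_words D \<Longrightarrow> x \<noteq> 0 \<Longrightarrow> \<forall>j. j \<noteq> i \<longrightarrow> n j = 0 \<Longrightarrow> x = chev_e D i \<and> n i = 1"
proof (induction rule: e_words.induct)
  case (gen j)
  then show ?case by (cases "j = i") auto
next
  case (step n x j)
  have "j = i"
    using step.prems(2) by (cases "j = i") (auto dest: spec[of _ j])
  moreover from step.prems(1) have "x \<noteq> 0" by (auto simp: br_simps)
  moreover from step.prems(2) \<open>j = i\<close> have "\<forall>l. l \<noteq> i \<longrightarrow> n l = 0" by auto
  ultimately show ?case using step.IH step.prems(1) by auto
qed

lemma sroot_eq_nat_comb: "\<alpha> i = nat_comb ((\<lambda>_. 0)(i := Suc 0))"
  using root_comb_Suc[of D "\<lambda>_. 0" i] by (simp add: fun_eq_iff del: fun_upd_apply)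

lemma chev_e_nonzero: "chev_e D i \<noteq> 0"
proof
  assume "chev_e D i = 0"
  then have "cart D (\<alpha>v i) = cart D 0"
    using br_e_f[of i i] by (simp add: br_simps linear_0[OF linear_cart])
  with inj_cart have "\<alpha>v i = 0" by (auto dest: injD)
  with scoroot_nonzero show False by auto
qed

lemma sroot_pos_root: "\<alpha> i \<in> pos_roots D"
proof -
  have "\<alpha> i \<noteq> (\<lambda>_. 0)"
    using sroot_scoroot_same[of i] by (intro notI) simp
  then have "\<alpha> i \<in> roots D"
    using chev_e_nonzero[of i] br_cart_e linear_sroot unfolding roots_def by blast
  moreover have "\<exists>n :: 'i \<Rightarrow> nat. \<alpha> i = nat_comb n" using sroot_eq_nat_comb by blast
  ultimately show ?thesis by (simp add: pos_roots_def root_comb_def[abs_def])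
qed

text \<open>\<open>s_i\<close> changes only the \<open>i\<close>-th coefficient. If the reflected
  root is not positive, all its coefficients are nonpositive, so \<open>\<beta>\<close> is supported
  on \<open>i\<close> alone and must be \<open>\<alpha> i\<close>.\<close>

lemma pos_root_reflect:
  assumes "\<beta> \<in> pos_roots D" "\<beta> \<noteq> \<alpha> i"
  shows "\<beta> \<circ> simple_reflection D i \<in> pos_roots D"
proof -
  from assms have root: "\<beta> \<in> roots D" and lin: "linear \<beta>" by (auto simp: pos_roots_def roots_def)
  from assms obtain n :: "'i \<Rightarrow> nat" where n: "\<beta> = nat_comb n"
    by (auto simp: pos_roots_def root_comb_def[abs_def])
  have refl: "\<beta> \<circ> simple_reflection D i \<in> roots D" by (rule root_reflect[OF root])
  from refl show ?thesis
  proof (cases rule: root_is_word_weight)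
    case (1 m x)
    then show ?thesis using refl by (auto simp: pos_roots_def root_comb_def[abs_def])
  next
    case (2 m x)
    let ?k = "\<beta> (\<alpha>v i)"
    have "root_comb D (\<lambda>j. real (n j) + (if j = i then - ?k else 0)) = root_comb D (\<lambda>j. (-1) * real (m j))"
    proof
      fix x
      have "root_comb D (\<lambda>j. real (n j) + (if j = i then - ?k else 0)) x = \<beta> x - ?k * \<alpha> i x"
        by (simp add: root_comb_add root_comb_delta n)
      also have "\<dots> = (\<beta> \<circ> simple_reflection D i) x"
        by (simp add: reflected_functional[OF lin])
      also have "\<dots> = (-1) * nat_comb m x" using 2 by simp
      finally show "root_comb D (\<lambda>j. real (n j) + (if j = i then - ?k else 0)) x = root_comb D (\<lambda>j. (-1) * real (m j)) x"
        by (simp only: root_comb_scale)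
    qed
    then have eq: "real (n j) + (if j = i then - ?k else 0) = (-1) * real (m j)" for j
      unfolding root_comb_inject by (rule fun_cong)
    have n0: "n j = 0" if "j \<noteq> i" for j using eq[of j] that by simp
    from root show ?thesis
    proof (cases rule: root_is_word_weight)
      case (1 n' x')
      then have "nat_comb n' = nat_comb n" using n by simp
      then have "(\<lambda>k. real (n' k)) = (\<lambda>k. real (n k))" by (simp only: root_comb_inject)
      then have "n' = n" by (simp add: fun_eq_iff)
      with 1 have "n i = 1" using e_word_single_letter[of n' x' i] n0 by auto
      then have "n = (\<lambda>_. 0)(i := Suc 0)" using n0 by auto
      with n assms(2) show ?thesis by (simp add: sroot_eq_nat_comb)
    next
      case (2 n' x')
      then have "nat_comb n = root_comb D (\<lambda>j. (-1) * real (n' j))"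
        using n by (simp only: root_comb_scale fun_eq_iff) simp
      then have eq: "real (n j) = (-1) * real (n' j)" for j
        unfolding root_comb_inject by (rule fun_cong)
      have "n j = 0" for j using eq[of j] by simp
      then have "\<beta> = (\<lambda>_. 0)" by (simp add: n root_comb_def fun_eq_iff)
      with root show ?thesis by (simp add: roots_def)
    qed
  qed
qed

end

section \<open>The Weyl group\<close>

lemma det_map_matrix_of_int: "det (map_matrix real_of_int A) = of_int (det A)"
  by (simp add: det_def)

locale km_weyl = km_algebra D
  for D :: "('i::finite, 'h::euclidean_space, 'g::real_vector, 'v) kac_moody_datum" +
  assumes sym: "symmetrizable (cartan D)" and det_nz: "det (cartan D) \<noteq> 0"
begin

abbreviation s where "s \<equiv> simple_reflection D"

lemma linear_s: "linear (s i)"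
  by (simp add: linear_iff simple_reflection_def linear_add[OF linear_sroot]
      linear_scale[OF linear_sroot] algebra_simps)

lemma s_s [simp]: "s i (s i x) = x"
  by (simp add: simple_reflection_def linear_diff[OF linear_sroot] linear_scale[OF linear_sroot])

section \<open>Coroot coordinates and the invariant form\<close>

lemma inj_scoroot: "inj \<alpha>v"
  and independent_scoroots: "independent (range \<alpha>v)"
proof -
  have indep: "c i = 0" if "(\<Sum>i\<in>UNIV. c i *\<^sub>R \<alpha>v i) = 0" for c i
    using real that unfolding realization_def by blast
  show inj: "inj \<alpha>v"
  proof (rule injI, rule ccontr)
    fix i j assume eq: "\<alpha>v i = \<alpha>v j" "i \<noteq> j"
    have "(\<Sum>k\<in>UNIV. ((if k = i then 1 else 0) - (if k = j then 1 else 0)) *\<^sub>R \<alpha>v k) = 0"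
      using eq(1) by (simp add: scaleR_diff_left sum_subtractf if_distrib[of "\<lambda>c. c *\<^sub>R _"] cong: if_cong)
    from indep[OF this, of i] eq(2) show False by simp
  qed
  show "independent (range \<alpha>v)"
  proof (rule independent_if_scalars_zero)
    fix f x assume "(\<Sum>x\<in>range \<alpha>v. f x *\<^sub>R x) = 0" "x \<in> range \<alpha>v"
    then show "f x = 0" using indep[of "\<lambda>i. f (\<alpha>v i)"] by (auto simp: sum.reindex[OF inj] o_def)
  qed simp
qed

text \<open>A nonsingular matrix has full rank \<open>r\<close>, so the realization has dimension
  \<open>2 r - r = r\<close> and the independent simple coroots form a basis.\<close>

lemma span_scoroots: "span (range \<alpha>v) = UNIV"
proof -
  have "rank (map_matrix real_of_int (cartan D)) = CARD('i)"
    using det_eq_0_rank[of "map_matrix real_of_int (cartan D)"] det_nz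
      rank_bound[of "map_matrix real_of_int (cartan D)"]
    by (simp add: det_map_matrix_of_int)
  then have "DIM('h) = card (range \<alpha>v)"
    using real by (simp add: realization_def card_image[OF inj_scoroot])
  then show ?thesis
    using card_ge_dim_independent[OF subset_UNIV independent_scoroots] by auto
qed

text \<open>The fundamental weights.\<close>

definition coord :: "'i \<Rightarrow> 'h \<Rightarrow> real" where
  "coord j = (SOME f. linear f \<and> (\<forall>i. f (\<alpha>v i) = (if i = j then 1 else 0)))"

lemma linear_coord: "linear (coord j)"
  and coord_scoroot [simp]: "coord j (\<alpha>v i) = (if i = j then 1 else 0)"
proof -
  have "\<exists>f. linear f \<and> (\<forall>i. f (\<alpha>v i) = (if i = j then 1 else (0::real)))"
    using linear_independent_extend[OF independent_scoroots, of "\<lambda>v. if v = \<alpha>v j then 1 else (0::real)"]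
    by (auto simp: inj_eq[OF inj_scoroot])
  from someI_ex[OF this] show "linear (coord j)" "coord j (\<alpha>v i) = (if i = j then 1 else 0)"
    by (auto simp: coord_def)
qed

lemma coord_expansion: "(\<Sum>j\<in>UNIV. coord j x *\<^sub>R \<alpha>v j) = x"
proof -
  have lin: "linear (\<lambda>x. \<Sum>j\<in>UNIV. coord j x *\<^sub>R \<alpha>v j)"
    by (simp add: linear_iff linear_add[OF linear_coord] linear_scale[OF linear_coord]
        scaleR_add_left sum.distrib scaleR_right.sum)
  have eq: "(\<Sum>j\<in>UNIV. coord j b *\<^sub>R \<alpha>v j) = id b" if "b \<in> range \<alpha>v" for b
    using that by (auto simp: if_distrib[of "\<lambda>c. c *\<^sub>R _"] cong: if_cong)
  have "x \<in> span (range \<alpha>v)" by (simp add: span_scoroots)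
  from linear_eq_on[OF lin linear_id this eq] show ?thesis by simp
qed

lemma linear_coord_expansion:
  fixes f :: "'h \<Rightarrow> 'a::real_vector"
  assumes "linear f"
  shows "f x = (\<Sum>j\<in>UNIV. coord j x *\<^sub>R f (\<alpha>v j))"
proof -
  have "f x = f (\<Sum>j\<in>UNIV. coord j x *\<^sub>R \<alpha>v j)" by (simp add: coord_expansion)
  then show ?thesis by (simp add: linear_sum[OF assms] linear_scale[OF assms])
qed

text \<open>Half the squared length of \<open>\<alpha>v i\<close> for the invariant form
  \<open>dualize\<close>.\<close>

definition eps :: "'i \<Rightarrow> real" where
  "eps = (SOME e. (\<forall>i. e i > 0) \<and> (\<forall>i j. e j * \<alpha> j (\<alpha>v i) = e i * \<alpha> i (\<alpha>v j)))"

text \<open>The \<open>d\<close> of \<open>symmetrizable\<close> may have either sign. Off the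
  diagonal \<open>a_ij\<close> and \<open>a_ji\<close> are both nonpositive, so the absolute values
  symmetrize as well. Positivity will keep the coroot coordinates of positive real roots
  nonnegative.\<close>

lemma eps_pos: "eps i > 0"
  and eps_sym: "eps j * \<alpha> j (\<alpha>v i) = eps i * \<alpha> i (\<alpha>v j)"
proof -
  from sym obtain d :: "'i \<Rightarrow> real" where d: "\<And>i. d i \<noteq> 0"
    "\<And>i j. d i * of_int (cartan D $ i $ j) = d j * of_int (cartan D $ j $ i)"
    unfolding symmetrizable_def by blast
  let ?e = "\<lambda>i. 1 / \<bar>d i\<bar>"
  have "?e j * \<alpha> j (\<alpha>v i) = ?e i * \<alpha> i (\<alpha>v j)" for i j
  proof (cases "i = j")
    case False
    then have le: "cartan D $ i $ j \<le> 0" "cartan D $ j $ i \<le> 0"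
      using gcm by (auto simp: generalized_cartan_matrix_def)
    have "\<bar>d i\<bar> * \<bar>of_int (cartan D $ i $ j)\<bar> = \<bar>d j\<bar> * \<bar>of_int (cartan D $ j $ i)\<bar>"
      using d(2)[of i j] by (simp flip: abs_mult)
    with le have "\<bar>d i\<bar> * of_int (cartan D $ i $ j) = \<bar>d j\<bar> * of_int (cartan D $ j $ i)"
      by (simp add: abs_of_nonpos)
    then show ?thesis using d(1)[of i] d(1)[of j] by (simp add: sroot_scoroot field_simps)
  qed simp
  moreover have "?e i > 0" for i using d(1)[of i] by simp
  ultimately have "\<exists>e::'i \<Rightarrow> real. (\<forall>i. e i > 0) \<and> (\<forall>i j. e j * \<alpha> j (\<alpha>v i) = e i * \<alpha> i (\<alpha>v j))"
    by (intro exI[of _ ?e]) blast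
  from someI_ex[OF this] show "eps i > 0" "eps j * \<alpha> j (\<alpha>v i) = eps i * \<alpha> i (\<alpha>v j)"
    unfolding eps_def by blast+
qed

text \<open>The isomorphism from the Cartan subalgebra to its dual given by the invariant form.\<close>

definition dualize :: "'h \<Rightarrow> 'h \<Rightarrow> real" where
  "dualize y = root_comb D (\<lambda>j. coord j y * eps j)"

lemma dualize_scoroot: "dualize (\<alpha>v i) x = eps i * \<alpha> i x"
  by (simp add: dualize_def root_comb_def if_distrib[of "\<lambda>c. c * _"] cong: if_cong)

lemma dualize_apply_scoroot: "dualize y (\<alpha>v i) = eps i * \<alpha> i y"
proof -
  have "dualize y (\<alpha>v i) = (\<Sum>j\<in>UNIV. coord j y * (eps j * \<alpha> j (\<alpha>v i)))"
    by (simp add: dualize_def root_comb_def mult_ac)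
  also have "\<dots> = eps i * (\<Sum>j\<in>UNIV. coord j y * \<alpha> i (\<alpha>v j))"
    unfolding eps_sym[of _ i] by (simp add: sum_distrib_left mult_ac)
  finally show ?thesis by (simp add: linear_coord_expansion[OF linear_sroot, of i y])
qed

lemma linear_dualize: "linear (dualize y)"
  by (simp add: dualize_def linear_root_comb)

lemma linear_dualize_left: "linear (\<lambda>y. dualize y x)"
  by (simp add: linear_iff dualize_def root_comb_def linear_add[OF linear_coord]
      linear_scale[OF linear_coord] algebra_simps sum.distrib sum_distrib_left)

lemma dualize_s: "dualize (s i y) x = dualize y (s i x)"
  by (simp add: simple_reflection_def linear_diff[OF linear_dualize] linear_scale[OF linear_dualize]
      linear_diff[OF linear_dualize_left] linear_scale[OF linear_dualize_left] dualize_scoroot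
      dualize_apply_scoroot)

lemma dualize_inject: "dualize y = dualize z \<longleftrightarrow> y = z"
proof
  assume "dualize y = dualize z"
  then have "coord j y * eps j = coord j z * eps j" for j
    unfolding dualize_def root_comb_inject by (rule fun_cong)
  then have "coord j y = coord j z" for j
    using eps_pos[of j] by (metis less_irrefl mult_right_cancel)
  then have "(\<Sum>j\<in>UNIV. coord j y *\<^sub>R \<alpha>v j) = (\<Sum>j\<in>UNIV. coord j z *\<^sub>R \<alpha>v j)"
    by (simp only:)
  then show "y = z" by (simp only: coord_expansion)
qed simp

lemma sroots_separate:
  assumes "\<And>i. \<alpha> i x = 0"
  shows "x = 0"
proof -
  have "dualize x y = dualize 0 y" for y
    using linear_coord_expansion[OF linear_dualize, of x y] assms
    by (simp add: dualize_apply_scoroot linear_0[OF linear_dualize_left])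
  then show ?thesis by (simp add: fun_eq_iff flip: dualize_inject)
qed

section \<open>Weyl group elements as words, and real coroots\<close>

primrec W :: "'i list \<Rightarrow> 'h \<Rightarrow> 'h" where
  "W [] = id"
| "W (i # is) = s i \<circ> W is"

lemma W_append: "W (xs @ ys) = W xs \<circ> W ys"
  by (induction xs) auto

lemma linear_W: "linear (W xs)"
proof (induction xs)
  case (Cons i xs)
  show ?case unfolding W.simps by (rule linear_compose[OF Cons linear_s])
qed (simp add: linear_iff)

lemma W_rev_W [simp]: "W (rev xs) (W xs x) = x"
  by (induction xs arbitrary: x) (auto simp: W_append)

lemma W_W_rev [simp]: "W xs (W (rev xs) x) = x"
  using W_rev_W[of "rev xs" x] by simp

lemma weyl_group_eq: "weyl_group D = range W"
proof safe
  fix w assume "w \<in> weyl_group D"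
  then show "w \<in> range W"
  proof induction
    case weyl_id
    show ?case by (metis W.simps(1) rangeI)
  next
    case (weyl_step w i)
    then obtain xs where "w = W xs" by blast
    then show ?case by (metis W.simps(2) rangeI)
  qed
next
  fix xs show "W xs \<in> weyl_group D"
    by (induction xs) (simp_all only: W.simps weyl_group.intros)
qed

lemma W_in_weyl_group: "W xs \<in> weyl_group D"
  by (simp add: weyl_group_eq)

lemma bij_W: "bij (W xs)"
  by (rule o_bij[of "W (rev xs)"]) (auto simp: fun_eq_iff)

lemma inv_W: "inv (W xs) = W (rev xs)"
  by (rule inv_equality) auto

lemma dualize_W: "dualize (W xs y) x = dualize y (W (rev xs) x)"
  by (induction xs arbitrary: x) (auto simp: dualize_s W_append)

text \<open>The invariant form sends both candidates to multiples of the same root, so they are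
  proportional; the root takes the value 2 on each, so they agree. This makes \<open>coroot\<close>
  well defined.\<close>

lemma real_coroot_unique:
  assumes "\<alpha> i \<circ> W us = \<alpha> k \<circ> W vs"
  shows "W (rev us) (\<alpha>v i) = W (rev vs) (\<alpha>v k)"
proof -
  let ?y = "W (rev us) (\<alpha>v i)" and ?z = "W (rev vs) (\<alpha>v k)"
  define \<beta> where "\<beta> = \<alpha> i \<circ> W us"
  have y: "dualize ?y x = eps i * \<beta> x" for x
    by (simp add: dualize_W dualize_scoroot \<beta>_def)
  have z: "dualize ?z x = eps k * \<beta> x" for x
    by (simp add: dualize_W dualize_scoroot \<beta>_def assms)
  have "\<beta> ?y = 2" by (simp add: \<beta>_def)
  have "\<beta> ?z = 2" by (simp add: \<beta>_def assms)
  have "dualize ((eps i / eps k) *\<^sub>R ?z) = dualize ?y"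
    using eps_pos[of k] by (auto simp: fun_eq_iff linear_scale[OF linear_dualize_left] y z)
  then have eq: "(eps i / eps k) *\<^sub>R ?z = ?y" by (simp only: dualize_inject)
  have "linear \<beta>" unfolding \<beta>_def by (rule linear_compose[OF linear_W linear_sroot])
  with arg_cong[OF eq, of \<beta>] \<open>\<beta> ?y = 2\<close> \<open>\<beta> ?z = 2\<close> have "eps i / eps k = 1"
    using eps_pos[of k] by (simp add: linear_scale field_simps)
  with eq show ?thesis by simp
qed

lemma coroot_real_root: "coroot D (\<alpha> i \<circ> W us) = W (rev us) (\<alpha>v i)"
  unfolding coroot_def
proof (rule the_equality)
  show "\<exists>w\<in>weyl_group D. \<exists>k. \<alpha> i \<circ> W us = dual_act w (\<alpha> k) \<and> W (rev us) (\<alpha>v i) = w (\<alpha>v k)"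
    by (rule bexI[of _ "W (rev us)"], rule exI[of _ i])
       (auto simp: dual_act_def inv_W W_in_weyl_group)
  fix y assume "\<exists>w\<in>weyl_group D. \<exists>k. \<alpha> i \<circ> W us = dual_act w (\<alpha> k) \<and> y = w (\<alpha>v k)"
  then obtain vs k where "\<alpha> i \<circ> W us = \<alpha> k \<circ> W (rev vs)" "y = W vs (\<alpha>v k)"
    by (auto simp: weyl_group_eq dual_act_def inv_W)
  then show "y = W (rev us) (\<alpha>v i)" using real_coroot_unique[of i us k "rev vs"] by simp
qed

text \<open>Integrality will bound a positive coordinate of a real coroot below by 1.\<close>

lemma coord_W_scoroot_int: "coord j (W xs (\<alpha>v i)) \<in> \<int>"
proof (induction xs arbitrary: j)
  case (Cons k xs)
  let ?y = "W xs (\<alpha>v i)"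
  have "\<alpha> k ?y = (\<Sum>l\<in>UNIV. coord l ?y * of_int (cartan D $ l $ k))"
    using linear_coord_expansion[OF linear_sroot, of k ?y] by (simp add: sroot_scoroot)
  also have "\<dots> \<in> \<int>" using Cons by (intro Ints_sum Ints_mult) auto
  finally show ?case
    using Cons[of j] by (auto simp: simple_reflection_def linear_diff[OF linear_coord] linear_scale[OF linear_coord])
qed auto

text \<open>The form is Weyl-invariant and carries \<open>\<alpha>v j\<close> to
  \<open>eps j\<close> times \<open>\<alpha> j\<close>; comparing coefficients of simple roots gives
  the ratio.\<close>

lemma real_coroot_coord:
  assumes "\<alpha> i \<circ> W us = nat_comb n"
  shows "coord j (W (rev us) (\<alpha>v i)) = real (n j) * (eps i / eps j)"
proof -
  let ?y = "W (rev us) (\<alpha>v i)"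
  have "dualize ?y x = eps i * (\<alpha> i \<circ> W us) x" for x
    by (simp add: dualize_W dualize_scoroot)
  then have "dualize ?y = root_comb D (\<lambda>j. eps i * real (n j))"
    by (simp add: assms root_comb_scale fun_eq_iff)
  then have "coord j ?y * eps j = eps i * real (n j)"
    unfolding dualize_def root_comb_inject by (rule fun_cong)
  then show ?thesis using eps_pos[of j] by (simp add: field_simps)
qed

text \<open>Apply the letters one by one. The reflection \<open>s k\<close> can take only
  \<open>\<alpha> k\<close> out of the positive roots, so at the first crossing the root reached is
  the simple root of the next letter.\<close>

lemma pos_root_turned_negative:
  assumes "\<beta> \<in> pos_roots D" "\<beta> \<circ> W ys \<notin> pos_roots D"
  obtains us k vs where "ys = us @ k # vs" "\<beta> \<circ> W us = \<alpha> k"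
proof -
  have "\<exists>us k vs. ys = us @ k # vs \<and> \<beta> \<circ> W us = \<alpha> k"
    using assms
  proof (induction ys arbitrary: \<beta>)
    case (Cons i ys)
    show ?case
    proof (cases "\<beta> = \<alpha> i")
      case True
      then show ?thesis by (intro exI[of _ "[]"]) auto
    next
      case False
      then have "\<beta> \<circ> s i \<in> pos_roots D" using Cons.prems by (intro pos_root_reflect)
      moreover have "\<beta> \<circ> s i \<circ> W ys \<notin> pos_roots D" using Cons.prems by (simp only: W.simps o_assoc not_False_eq_True)
      ultimately obtain us k vs where "ys = us @ k # vs" "\<beta> \<circ> s i \<circ> W us = \<alpha> k"
        using Cons.IH by blast
      then have "i # ys = (i # us) @ k # vs \<and> \<beta> \<circ> W (i # us) = \<alpha> k" by (simp add: o_assoc)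
      then show ?thesis by blast
    qed
  qed simp
  with that show thesis by blast
qed

text \<open>The exchange condition: at the crossing \<open>W us\<close> carries
  \<open>\<alpha>v k\<close> to \<open>\<alpha>v i\<close>, so
  \<open>s i \<circ> W us = W us \<circ> s k\<close> and the letter \<open>k\<close>
  cancels.\<close>

lemma weyl_exchange:
  assumes "\<alpha> i \<circ> W ys \<notin> pos_roots D"
  obtains zs where "length zs < length ys" "W (i # ys) = W zs"
proof -
  from pos_root_turned_negative[OF sroot_pos_root assms] obtain us k vs
    where ys: "ys = us @ k # vs" and eq: "\<alpha> i \<circ> W us = \<alpha> k" .
  have "W us (\<alpha>v k) = \<alpha>v i"
    using real_coroot_unique[of i us k "[]"] eq W_W_rev[of us "\<alpha>v i"] by simp
  then have "s i (W us x) = W us (s k x)" for x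
    using fun_cong[OF eq, of x]
    by (simp add: simple_reflection_def linear_diff[OF linear_W] linear_scale[OF linear_W])
  then have "W (i # ys) = W (us @ vs)"
    by (auto simp: fun_eq_iff ys W_append)
  moreover have "length (us @ vs) < length ys" by (simp add: ys)
  ultimately show thesis using that by blast
qed

text \<open>Prepending \<open>k\<close> to \<open>zs\<close> adds
  \<open>(\<alpha> k \<circ> W zs) x\<close> times \<open>\<alpha>v k\<close>. If this functional is
  a positive root, its coefficients are natural numbers; otherwise exchange gives a shorter word for
  the same element.\<close>

lemma weyl_displacement:
  "\<exists>m :: 'i \<Rightarrow> 'i \<Rightarrow> nat. \<forall>x. x - W ys x = (\<Sum>i\<in>UNIV. nat_comb (m i) x *\<^sub>R \<alpha>v i)"
proof (induction ys rule: length_induct)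
  case (1 ys)
  show ?case
  proof (cases ys)
    case Nil
    then show ?thesis by (intro exI[of _ "\<lambda>_ _. 0"]) simp
  next
    case (Cons k zs)
    show ?thesis
    proof (cases "\<alpha> k \<circ> W zs \<in> pos_roots D")
      case True
      then obtain n :: "'i \<Rightarrow> nat" where n: "\<alpha> k \<circ> W zs = nat_comb n"
        by (auto simp: pos_roots_def root_comb_def[abs_def])
      from 1 Cons obtain m :: "'i \<Rightarrow> 'i \<Rightarrow> nat"
        where m: "\<And>x. x - W zs x = (\<Sum>i\<in>UNIV. nat_comb (m i) x *\<^sub>R \<alpha>v i)" by force
      have "x - W ys x = (\<Sum>i\<in>UNIV. nat_comb (\<lambda>j. m i j + (if i = k then n j else 0)) x *\<^sub>R \<alpha>v i)" for x
      proof -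
        have "nat_comb (\<lambda>j. m i j + (if i = k then n j else 0)) x
            = nat_comb (m i) x + (if i = k then nat_comb n x else 0)" for i
          by (simp add: root_comb_add)
        moreover have "x - W ys x = (x - W zs x) + nat_comb n x *\<^sub>R \<alpha>v k"
          using fun_cong[OF n, of x] by (simp add: Cons simple_reflection_def)
        ultimately show ?thesis
          by (simp add: m scaleR_add_left sum.distrib if_distrib[of "\<lambda>c. c *\<^sub>R _"] cong: if_cong)
      qed
      then show ?thesis by (intro exI[of _ "\<lambda>i j. m i j + (if i = k then n j else 0)"]) blast
    next
      case False
      then obtain us where "length us < length zs" "W ys = W us"
        using weyl_exchange Cons by metis
      then show ?thesis using 1 Cons by auto
    qed
  qed
qed


section \<open>Displacement by Weyl elements and the orbit of rho\<close>

definition displacement :: "('h \<Rightarrow> 'h) \<Rightarrow> 'i \<Rightarrow> 'i \<Rightarrow> nat" where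
  "displacement w = (SOME m. \<forall>x. x - w x = (\<Sum>i\<in>UNIV. nat_comb (m i) x *\<^sub>R \<alpha>v i))"

lemma displacement:
  assumes "w \<in> weyl_group D"
  shows "x - w x = (\<Sum>i\<in>UNIV. nat_comb (displacement w i) x *\<^sub>R \<alpha>v i)"
proof -
  from assms obtain xs where "w = W xs" by (auto simp: weyl_group_eq)
  with someI_ex[OF weyl_displacement[of xs]] show ?thesis
    unfolding displacement_def by blast
qed

lemma displacement_functional:
  fixes f :: "'h \<Rightarrow> real"
  assumes "w \<in> weyl_group D" "linear f"
  shows "f (w x) = f x - (\<Sum>i\<in>UNIV. nat_comb (displacement w i) x * f (\<alpha>v i))"
proof -
  have "f x - f (w x) = f (x - w x)" by (simp add: linear_diff[OF assms(2)])
  also have "\<dots> = (\<Sum>i\<in>UNIV. nat_comb (displacement w i) x * f (\<alpha>v i))"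
    by (simp add: displacement[OF assms(1)] linear_sum[OF assms(2)] linear_scale[OF assms(2)])
  finally show ?thesis by simp
qed

lemma sum_nat_comb:
  "(\<Sum>i\<in>UNIV. nat_comb (m i) x) = nat_comb (\<lambda>j. \<Sum>i\<in>(UNIV::'i set). m i j) x"
  by (simp add: root_comb_def sum_distrib_right) (rule sum.swap)

text \<open>The coefficients of \<open>\<rho> - w\<^sup>-\<^sup>1\<rho>\<close> with respect to the simple roots.\<close>

definition rho_defect :: "('h \<Rightarrow> 'h) \<Rightarrow> 'i \<Rightarrow> nat" where
  "rho_defect w j = (\<Sum>i\<in>UNIV. displacement w i j)"

lemma rho_defect_zero:
  assumes "w \<in> weyl_group D" "\<And>j. rho_defect w j = 0"
  shows "w = id"
proof
  fix x
  have "displacement w i j = 0" for i j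
    using assms(2)[of j] by (simp add: rho_defect_def)
  then have "nat_comb (displacement w i) x = 0" for i
    by (simp add: root_comb_def)
  with displacement[OF assms(1), of x] show "w x = id x" by simp
qed

text \<open>The sum \<open>?r\<close> of the fundamental weights is 1 on every simple coroot, so it
  is rho. Equal defects mean \<open>?r \<circ> w = ?r \<circ> w'\<close>; then
  \<open>w \<circ> inv w'\<close> fixes rho, has defect zero and is the identity.\<close>

lemma inj_on_rho_defect: "inj_on rho_defect (weyl_group D)"
proof (rule inj_onI)
  fix w w' assume w: "w \<in> weyl_group D" "w' \<in> weyl_group D" "rho_defect w = rho_defect w'"
  let ?r = "\<lambda>x. \<Sum>j\<in>UNIV. coord j x"
  have lin: "linear ?r"
    by (simp add: linear_iff linear_add[OF linear_coord] linear_scale[OF linear_coord] sum.distrib sum_distrib_left)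
  have r: "?r (v x) = ?r x - nat_comb (rho_defect v) x" if "v \<in> weyl_group D" for v x
    using displacement_functional[OF that lin, of x] by (simp add: sum_nat_comb rho_defect_def[abs_def])
  obtain xs ys where xs: "w = W xs" and ys: "w' = W ys" using w by (auto simp: weyl_group_eq)
  let ?v = "W (xs @ rev ys)"
  have v: "?v \<in> weyl_group D" by (rule W_in_weyl_group)
  have "nat_comb (rho_defect ?v) x = 0" for x
  proof -
    have "?r (?v x) = ?r (w (W (rev ys) x))" by (simp add: W_append xs)
    also have "\<dots> = ?r (w' (W (rev ys) x))" by (simp only: r w)
    also have "\<dots> = ?r x" by (simp add: ys)
    finally show ?thesis using r[OF v, of x] by simp
  qed
  then have "nat_comb (rho_defect ?v) = root_comb D (\<lambda>_. 0)" by (simp add: fun_eq_iff)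
  then have "(\<lambda>j. real (rho_defect ?v j)) = (\<lambda>_. 0)" by (simp only: root_comb_inject)
  then have "rho_defect ?v j = 0" for j by (simp add: fun_eq_iff)
  from rho_defect_zero[OF v this] have "W xs (W (rev ys) x) = x" for x
    by (metis W_append comp_apply id_apply)
  from this[of "W ys _"] show "w = w'" by (simp add: fun_eq_iff xs ys)
qed

end

lemma geometric_prod_summable:
  fixes q :: "'i::finite \<Rightarrow> real"
  assumes q: "\<And>j. 0 < q j" "\<And>j. q j < 1"
  shows "(\<lambda>n :: 'i \<Rightarrow> nat. \<Prod>j\<in>UNIV. q j ^ n j) summable_on UNIV"
proof (rule nonneg_bdd_above_summable_on)
  show "0 \<le> (\<Prod>j\<in>UNIV. q j ^ n j)" for n
    using q by (intro prod_nonneg ballI zero_le_power) (simp add: less_imp_le)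
  show "bdd_above (sum (\<lambda>n :: 'i \<Rightarrow> nat. \<Prod>j\<in>UNIV. q j ^ n j) ` {F. F \<subseteq> UNIV \<and> finite F})"
  proof (rule bdd_aboveI, elim imageE, clarsimp)
    fix F :: "('i \<Rightarrow> nat) set" assume F: "finite F"
    \<comment> \<open>\<open>K\<close> bounds every entry of every index in \<open>F\<close>, so
      \<open>F\<close> lies in a box, over which the sum factors.\<close>
    define K where "K = (\<Sum>n\<in>F. \<Sum>j\<in>UNIV. n j)"
    have le: "n j \<le> K" if "n \<in> F" for n j
    proof -
      have "n j \<le> (\<Sum>j\<in>UNIV. n j)" by (rule member_le_sum) auto
      also have "\<dots> \<le> K" unfolding K_def by (rule member_le_sum[OF that]) (auto simp: F)
      finally show ?thesis .
    qed
    have "(\<Sum>n\<in>F. \<Prod>j\<in>UNIV. q j ^ n j) \<le> (\<Sum>n\<in>PiE UNIV (\<lambda>_. {..K}). \<Prod>j\<in>UNIV. q j ^ n j)"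
    proof (rule sum_mono2)
      show "finite (PiE UNIV (\<lambda>_ :: 'i. {..K}))" by (intro finite_PiE) auto
      show "F \<subseteq> PiE UNIV (\<lambda>_. {..K})" using le by (auto simp: PiE_def)
      show "0 \<le> (\<Prod>j\<in>UNIV. q j ^ n j)" for n
        using q by (intro prod_nonneg ballI zero_le_power) (simp add: less_imp_le)
    qed
    also have "\<dots> = (\<Prod>j\<in>UNIV. \<Sum>k\<le>K. q j ^ k)"
      by (rule prod_sum_PiE[symmetric]) auto
    also have "\<dots> \<le> (\<Prod>j\<in>UNIV. 1 / (1 - q j))"
    proof (intro prod_mono conjI sum_nonneg)
      fix j
      show "(\<Sum>k\<le>K. q j ^ k) \<le> 1 / (1 - q j)"
        using q[of j] sum_le_suminf[of "\<lambda>k. q j ^ k" "{..K}"] by (simp add: suminf_geometric summable_geometric)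
    qed (use q in \<open>auto intro: less_imp_le\<close>)
    finally show "(\<Sum>n\<in>F. \<Prod>j\<in>UNIV. q j ^ n j) \<le> (\<Prod>j\<in>UNIV. 1 / (1 - q j))" .
  qed
qed

section \<open>Exponential sums over the Weyl group\<close>

context km_weyl
begin

lemma weyl_exp_sum_chamber:
  fixes L :: "'h \<Rightarrow> real"
  assumes L: "linear L" "\<And>i. L (\<alpha>v i) \<ge> 1" and x: "x \<in> chamber D"
  shows "(\<lambda>w. exp (L (w x))) summable_on weyl_group D"
proof -
  have ax: "\<alpha> j x > 0" for j using x by (simp add: chamber_def)
  let ?q = "\<lambda>j. exp (- \<alpha> j x)"
  let ?g = "\<lambda>n :: 'i \<Rightarrow> nat. \<Prod>j\<in>UNIV. ?q j ^ n j"
  have "?g summable_on UNIV" by (rule geometric_prod_summable) (use ax in auto)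
  then have "?g summable_on rho_defect ` weyl_group D"
    by (rule summable_on_subset_banach) simp
  then have "(?g \<circ> rho_defect) summable_on weyl_group D"
    by (simp add: summable_on_reindex[OF inj_on_rho_defect])
  then have "(\<lambda>w. exp (L x) * (?g \<circ> rho_defect) w) summable_on weyl_group D"
    by (rule summable_on_cmult_right)
  then show ?thesis
  proof (rule summable_on_comparison_test)
    fix w assume w: "w \<in> weyl_group D"
    have "nat_comb (displacement w i) x \<ge> 0" for i
      unfolding root_comb_def using ax by (intro sum_nonneg mult_nonneg_nonneg) (auto intro: less_imp_le)
    \<comment> \<open>Since the coefficients are nonnegative on the chamber, the values of
      \<open>L\<close> on coroots may be lowered to 1; what remains is the pairing of
      \<open>x\<close> with the defect of rho.\<close>
    then have "(\<Sum>i\<in>UNIV. nat_comb (displacement w i) x * 1) \<le> (\<Sum>i\<in>UNIV. nat_comb (displacement w i) x * L (\<alpha>v i))"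
      using L(2) by (intro sum_mono mult_left_mono)
    then have "L (w x) \<le> L x - nat_comb (rho_defect w) x"
      unfolding displacement_functional[OF w L(1)] by (simp add: sum_nat_comb rho_defect_def[abs_def])
    then have "exp (L (w x)) \<le> exp (L x) * exp (- nat_comb (rho_defect w) x)"
      by (simp flip: exp_add)
    also have "exp (- nat_comb (rho_defect w) x) = ?g (rho_defect w)"
      by (simp add: root_comb_def exp_sum flip: sum_negf exp_of_nat_mult)
    finally show "exp (L (w x)) \<le> exp (L x) * (?g \<circ> rho_defect) w" by simp
  qed simp
qed

text \<open>Convexity of the exponential extends convergence from the chambers to their convex hull,
  whose interior contains the interior of the Tits cone because the chambers are dense there.\<close>

lemma weyl_exp_sum_hull:
  fixes L :: "'h \<Rightarrow> real"
  assumes L: "linear L" "\<And>i. L (\<alpha>v i) \<ge> 1"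
    and x: "x \<in> convex hull (\<Union>w\<in>weyl_group D. w ` chamber D)"
  shows "(\<lambda>w. exp (L (inv w x))) summable_on weyl_group D"
proof -
  let ?S = "{x. (\<lambda>w. exp (L (inv w x))) summable_on weyl_group D}"
  have "convex ?S"
  proof (rule convexI, clarsimp)
    fix x' y' :: 'h and u v :: real
    assume sum: "(\<lambda>w. exp (L (inv w x'))) summable_on weyl_group D"
      "(\<lambda>w. exp (L (inv w y'))) summable_on weyl_group D" and uv: "0 \<le> u" "0 \<le> v" "u + v = 1"
    have u: "u = 1 - v" using uv by simp
    have "(\<lambda>w. u * exp (L (inv w x')) + v * exp (L (inv w y'))) summable_on weyl_group D"
      by (intro summable_on_add summable_on_cmult_right sum)
    then show "(\<lambda>w. exp (L (inv w (u *\<^sub>R x' + v *\<^sub>R y')))) summable_on weyl_group D"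
    proof (rule summable_on_comparison_test)
      fix w assume "w \<in> weyl_group D"
      then obtain xs where "w = W xs" by (auto simp: weyl_group_eq)
      then have "L (inv w (u *\<^sub>R x' + v *\<^sub>R y')) = u * L (inv w x') + v * L (inv w y')"
        by (simp add: inv_W linear_add[OF linear_W] linear_scale[OF linear_W] linear_add[OF L(1)] linear_scale[OF L(1)])
      then show "exp (L (inv w (u *\<^sub>R x' + v *\<^sub>R y'))) \<le> u * exp (L (inv w x')) + v * exp (L (inv w y'))"
        using convex_onD[OF exp_convex, of v "L (inv w x')" "L (inv w y')"] uv u by simp
    qed simp
  qed
  moreover have "(\<Union>w\<in>weyl_group D. w ` chamber D) \<subseteq> ?S"
  proof clarsimp
    fix w0 z assume w0: "w0 \<in> weyl_group D" and z: "z \<in> chamber D"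
    obtain ys where ys: "w0 = W ys" using w0 by (auto simp: weyl_group_eq)
    \<comment> \<open>This bijection makes the series at \<open>w0 z\<close> a rearrangement of the
      one at \<open>z\<close>, which the chamber case covers.\<close>
    have "bij_betw (\<lambda>w. inv w \<circ> w0) (weyl_group D) (weyl_group D)"
    proof (rule bij_betw_byWitness[where f' = "\<lambda>w. w0 \<circ> inv w"])
      show "\<forall>w\<in>weyl_group D. w0 \<circ> inv (inv w \<circ> w0) = w"
        by (auto simp: weyl_group_eq ys inv_W fun_eq_iff o_inv_distrib bij_W inv_inv_eq)
      show "\<forall>w\<in>weyl_group D. inv (w0 \<circ> inv w) \<circ> w0 = w"
        by (auto simp: weyl_group_eq ys inv_W fun_eq_iff o_inv_distrib bij_W inv_inv_eq)
      have "inv w \<circ> w0 \<in> weyl_group D" "w0 \<circ> inv w \<in> weyl_group D" if "w \<in> weyl_group D" for w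
        using that W_append by (auto simp: weyl_group_eq ys inv_W image_iff) metis+
      then show "(\<lambda>w. inv w \<circ> w0) ` weyl_group D \<subseteq> weyl_group D"
        "(\<lambda>w. w0 \<circ> inv w) ` weyl_group D \<subseteq> weyl_group D" by auto
    qed
    from summable_on_reindex_bij_betw[OF this, of "\<lambda>w. exp (L (w z))"] weyl_exp_sum_chamber[OF L z]
    show "(\<lambda>w. exp (L (inv w (w0 z)))) summable_on weyl_group D" by simp
  qed
  ultimately have "convex hull (\<Union>w\<in>weyl_group D. w ` chamber D) \<subseteq> ?S"
    by (intro hull_minimal)
  with x show ?thesis by auto
qed

text \<open>Every translate of the closed chamber lies in the closure of the hull, and a convex set
  has the same interior as its closure.\<close>

lemma interior_tits_cone_subset:
  "interior (tits_cone D) \<subseteq> interior (convex hull (\<Union>w\<in>weyl_group D. w ` chamber D))" (is "_ \<subseteq> interior ?K")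
proof -
  have "tits_cone D \<subseteq> closure ?K"
    unfolding tits_cone_def
  proof (intro UN_least)
    fix w assume w: "w \<in> weyl_group D"
    then obtain xs where xs: "w = W xs" by (auto simp: weyl_group_eq)
    have "w ` closure (chamber D) \<subseteq> closure (w ` chamber D)"
      unfolding xs by (rule closure_linear_image_subset[OF linear_W])
    also have "w ` chamber D \<subseteq> ?K" using w by (intro subset_trans[OF _ hull_subset]) auto
    finally show "w ` closure (chamber D) \<subseteq> closure ?K" by (simp add: closure_mono)
  qed
  then have "interior (tits_cone D) \<subseteq> interior (closure ?K)" by (rule interior_mono)
  also have "\<dots> = interior ?K" by (intro convex_interior_closure convex_convex_hull)
  finally show ?thesis .
qed

text \<open>A convex function on a polytope is bounded by its values at the vertices. Compactness
  covers \<open>C\<close> by finitely many cubes with vertices in the hull; summing over all these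
  vertices removes the dependence on \<open>x\<close>.\<close>

lemma weyl_exp_sum_majorant:
  fixes L :: "'h \<Rightarrow> real"
  assumes L: "linear L" "\<And>i. L (\<alpha>v i) \<ge> 1" and C: "compact C" "C \<subseteq> interior (tits_cone D)"
  obtains M where "M summable_on weyl_group D"
    "\<And>w x. w \<in> weyl_group D \<Longrightarrow> x \<in> C \<Longrightarrow> exp (L (inv w x)) \<le> M w"
proof -
  let ?K = "convex hull (\<Union>w\<in>weyl_group D. w ` chamber D)"
  have "\<exists>P. finite P \<and> P \<subseteq> ?K \<and> x \<in> interior (convex hull P)" if "x \<in> C" for x
  proof -
    from that C interior_tits_cone_subset have "x \<in> interior ?K" by blast
    then obtain e where e: "e > 0" "cball x e \<subseteq> ?K" by (auto simp: mem_interior_cball)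
    \<comment> \<open>Coordinates of \<open>y - x\<close> in the cube are at most \<open>d\<close>,
      so dividing by the dimension bounds the l1 norm, and with it the norm, by
      \<open>e\<close>.\<close>
    define d where "d = e / real DIM('h)"
    have d: "d > 0" using e by (simp add: d_def)
    let ?c = "\<Sum>i\<in>Basis. d *\<^sub>R i :: 'h"
    obtain P where P: "finite P" "cbox (x - ?c) (x + ?c) = convex hull P"
      using cube_convex_hull[OF d] by blast
    have "cbox (x - ?c) (x + ?c) \<subseteq> cball x e"
    proof
      fix y assume y: "y \<in> cbox (x - ?c) (x + ?c)"
      have "norm (y - x) \<le> (\<Sum>i\<in>Basis. \<bar>(y - x) \<bullet> i\<bar>)" by (rule norm_le_l1)
      also have "\<dots> \<le> (\<Sum>i\<in>(Basis::'h set). d)"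
        using y by (intro sum_mono) (auto simp: mem_box inner_simps abs_le_iff algebra_simps dest!: bspec)
      also have "\<dots> = e" by (simp add: d_def)
      finally show "y \<in> cball x e" by (simp add: dist_norm norm_minus_commute)
    qed
    with e P have "convex hull P \<subseteq> ?K" by auto
    then have "P \<subseteq> ?K" using hull_subset[of P convex] by blast
    moreover have "x \<in> interior (convex hull P)"
      unfolding P(2)[symmetric] interior_cbox using d by (auto simp: mem_box inner_simps)
    ultimately show ?thesis using P(1) by blast
  qed
  then obtain P where P: "\<And>x. x \<in> C \<Longrightarrow> finite (P x) \<and> P x \<subseteq> ?K \<and> x \<in> interior (convex hull P x)"
    by metis
  have "C \<subseteq> (\<Union>x\<in>C. interior (convex hull P x))" using P by blast
  then obtain C' where C': "C' \<subseteq> C" "finite C'" "C \<subseteq> (\<Union>x\<in>C'. interior (convex hull P x))"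
    using compactE_image[OF C(1), of C "\<lambda>x. interior (convex hull P x)"] by (metis open_interior)
  define Q where "Q = (\<Union>x\<in>C'. P x)"
  have Q: "finite Q" "Q \<subseteq> ?K" using P C' by (auto simp: Q_def)
  show thesis
  proof
    show "(\<lambda>w. \<Sum>p\<in>Q. exp (L (inv w p))) summable_on weyl_group D"
      using Q
    proof (induction Q rule: finite_induct)
      case (insert p Q)
      then show ?case by (auto intro!: summable_on_add weyl_exp_sum_hull L)
    qed simp
    fix w x assume w: "w \<in> weyl_group D" and x: "x \<in> C"
    obtain xs where xs: "w = W xs" using w by (auto simp: weyl_group_eq)
    have lin: "linear (\<lambda>y. L (inv w y))"
      unfolding xs inv_W using linear_compose[OF linear_W L(1)] by (simp add: o_def)
    from x C' obtain x' where x': "x' \<in> C'" "x \<in> convex hull P x'" using interior_subset by blast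
    have "convex_on UNIV (\<lambda>y. exp (L (inv w y)))"
    proof (rule convex_onI)
      fix t :: real and y z :: 'h assume t: "0 < t" "t < 1"
      have "L (inv w ((1 - t) *\<^sub>R y + t *\<^sub>R z)) = (1 - t) * L (inv w y) + t * L (inv w z)"
        by (simp add: linear_add[OF lin] linear_scale[OF lin])
      then show "exp (L (inv w ((1 - t) *\<^sub>R y + t *\<^sub>R z))) \<le> (1 - t) * exp (L (inv w y)) + t * exp (L (inv w z))"
        using convex_onD[OF exp_convex, of t "L (inv w y)" "L (inv w z)"] t by simp
    qed simp
    then have "convex_on (convex hull P x') (\<lambda>y. exp (L (inv w y)))"
      by (rule convex_on_subset) auto
    moreover have "\<forall>p\<in>P x'. exp (L (inv w p)) \<le> (\<Sum>p\<in>Q. exp (L (inv w p)))"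
      using Q x' by (intro ballI member_le_sum) (auto simp: Q_def)
    ultimately show "exp (L (inv w x)) \<le> (\<Sum>p\<in>Q. exp (L (inv w p)))"
      using convex_on_convex_hull_bound x'(2) by blast
  qed
qed

end

section \<open>The highest weight module and the Iwasawa decomposition\<close>

lemma op_exp_eigenvector:
  fixes T :: "'v::real_normed_vector \<Rightarrow> 'v"
  assumes "linear T" "T v = c *\<^sub>R v"
  shows "(\<lambda>n. (T ^^ n) v /\<^sub>R fact n) sums (exp c *\<^sub>R v)"
proof -
  have "(T ^^ n) v = (c ^ n) *\<^sub>R v" for n
    by (induction n) (simp_all add: linear_scale[OF assms(1)] assms(2) mult.commute)
  moreover have "(\<lambda>n. (c ^ n /\<^sub>R fact n) *\<^sub>R v) sums (exp c *\<^sub>R v)"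
    by (rule bounded_linear.sums[OF bounded_linear_scaleR_left exp_converges])
  ultimately show ?thesis by simp
qed

locale km_module = km_weyl D
  for D :: "('i::finite, 'h::euclidean_space, 'g::real_vector, 'v::real_inner) kac_moody_datum" +
  fixes \<Lambda> :: "'h \<Rightarrow> real" and v0 :: 'v
  assumes hw: "highest_weight_module D"
    and linear_Lambda: "linear \<Lambda>" and Lambda_pos: "\<And>i. \<Lambda> (scoroot D i) > 0"
    and v0_nonzero: "v0 \<noteq> 0" and cart_v0: "\<And>x. act D (cart D x) v0 = \<Lambda> x *\<^sub>R v0"
    and e_v0: "\<And>i. act D (chev_e D i) v0 = 0"
begin

lemma linear_act: "linear (act D x)" and linear_act_left: "linear (\<lambda>x. act D x v)"
  using hw by (auto simp: highest_weight_module_def)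

lemma act_br: "act D (br x y) v = act D x (act D y v) - act D y (act D x v)"
  using hw unfolding highest_weight_module_def by blast

lemma contravariant: "act D (chev_e D i) v \<bullet> w = v \<bullet> act D (chev_f D i) w"
  using hw unfolding highest_weight_module_def by blast

lemmas act_simps = linear_add[OF linear_act] linear_scale[OF linear_act] linear_0[OF linear_act]
  linear_diff[OF linear_act] linear_neg[OF linear_act]
  linear_add[OF linear_act_left] linear_scale[OF linear_act_left] linear_0[OF linear_act_left]
  linear_diff[OF linear_act_left] linear_neg[OF linear_act_left]

inductive_set f_words :: "(('i \<Rightarrow> nat) \<times> 'v) set" where
  top: "((\<lambda>_. 0), v0) \<in> f_words"
| step: "(n, v) \<in> f_words \<Longrightarrow> (n(i := Suc (n i)), act D (chev_f D i) v) \<in> f_words"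

lemma act_cart_f: "act D (cart D x) (act D (chev_f D i) v)
    = act D (chev_f D i) (act D (cart D x) v) - \<alpha> i x *\<^sub>R act D (chev_f D i) v"
  using act_br[of "cart D x" "chev_f D i" v] by (simp add: act_simps algebra_simps)

lemma act_e_f: "act D (chev_e D j) (act D (chev_f D i) v)
    = act D (chev_f D i) (act D (chev_e D j) v) + (if i = j then act D (cart D (\<alpha>v i)) v else 0)"
  using act_br[of "chev_e D j" "chev_f D i" v] by (auto simp: br_e_f act_simps algebra_simps)

lemma f_word_act_cart: "(n, v) \<in> f_words \<Longrightarrow> act D (cart D x) v = (\<Lambda> x - nat_comb n x) *\<^sub>R v"
proof (induction rule: f_words.induct)
  case top
  show ?case by (simp add: cart_v0)
next
  case (step n v i)
  show ?case
    unfolding act_cart_f step.IH root_comb_Suc by (simp add: act_simps algebra_simps)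
qed

lemma f_word_zero: "(n, v) \<in> f_words \<Longrightarrow> \<forall>j. n j = 0 \<Longrightarrow> v = v0"
  by (erule f_words.cases) (simp, metis fun_upd_same nat.distinct(1))

text \<open>Raising operators are commuted through the lowering ones down to \<open>v0\<close>, so
  the span is a submodule. It contains \<open>v0\<close>, and irreducibility makes it
  everything.\<close>

lemma span_f_words: "span (snd ` f_words) = UNIV"
proof -
  let ?S = "span (snd ` f_words)"
  have stable_gen: "act D y v \<in> ?S"
    if gen: "\<And>n w. (n, w) \<in> f_words \<Longrightarrow> act D y w \<in> ?S" and "v \<in> ?S" for y v
  proof -
    have "act D y v \<in> span (act D y ` snd ` f_words)"
      using that(2) linear_act linear_span_image by blast
    also have "\<dots> \<subseteq> ?S" using gen by (intro span_minimal) auto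
    finally show ?thesis .
  qed
  have f: "act D (chev_f D i) v \<in> ?S" if "v \<in> ?S" for i v
    using that
  proof (rule stable_gen[rotated])
    fix n w assume "(n, w) \<in> f_words"
    then have "act D (chev_f D i) w \<in> snd ` f_words" by (metis f_words.step image_eqI snd_conv)
    then show "act D (chev_f D i) w \<in> ?S" by (rule span_base)
  qed
  have cart: "act D (cart D x) v \<in> ?S" if "v \<in> ?S" for x v
    using that
  proof (rule stable_gen[rotated])
    fix n w assume w: "(n, w) \<in> f_words"
    then have "w \<in> ?S" by (force intro: span_base)
    then show "act D (cart D x) w \<in> ?S" by (simp only: f_word_act_cart[OF w] span_scale)
  qed
  have e_word: "act D (chev_e D i) w \<in> ?S" if "(n, w) \<in> f_words" for i n w
    using that
  proof (induction rule: f_words.induct)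
    case top
    show ?case by (simp add: e_v0 span_zero)
  next
    case (step n v j)
    have "v \<in> ?S" using step.hyps by (force intro: span_base)
    then show ?case
      unfolding act_e_f using step.IH by (auto intro!: span_add f cart span_zero)
  qed
  have "act D y v \<in> ?S" if "v \<in> ?S" for y v
    using that
  proof (induction y arbitrary: v rule: lie_generated_induct)
    case (e i)
    then show ?case by (rule stable_gen[rotated]) (rule e_word)
  qed (auto simp: act_simps act_br span_zero intro: f cart span_add span_scale span_diff)
  then have "?S = {0} \<or> ?S = UNIV"
    using hw unfolding highest_weight_module_def by (metis subspace_span)
  moreover have "v0 \<in> ?S" using f_words.top by (force intro: span_base)
  ultimately show ?thesis using v0_nonzero by auto
qed

lemma weight_space_subset_span:
  "weight_space D \<mu> \<subseteq> span {w. \<exists>n. (n, w) \<in> f_words \<and> \<mu> = (\<lambda>x. \<Lambda> x - nat_comb n x)}"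
proof
  fix y assume y: "y \<in> weight_space D \<mu>"
  let ?P = "\<lambda>\<mu> w. \<exists>n. (n, w) \<in> f_words \<and> \<mu> = (\<lambda>x. \<Lambda> x - nat_comb n x)"
  have "y \<in> span {b \<in> snd ` f_words. ?P \<mu> b \<and> (\<forall>x. act D (cart D x) b = \<mu> x *\<^sub>R b)}"
  proof (rule weight_vector_in_span_same_weight)
    show "y \<in> span (snd ` f_words)" by (simp add: span_f_words)
    show "act D (cart D x) y = \<mu> x *\<^sub>R y" for x using y by (simp add: weight_space_def)
    fix b assume "b \<in> snd ` f_words"
    then obtain n where n: "(n, b) \<in> f_words" by force
    then show "\<exists>\<mu>. ?P \<mu> b \<and> (\<forall>x. act D (cart D x) b = \<mu> x *\<^sub>R b)"
      using f_word_act_cart[OF n] by (intro exI[of _ "\<lambda>x. \<Lambda> x - nat_comb n x"]) blast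
  qed (rule linear_act)
  also have "\<dots> \<subseteq> span {w. ?P \<mu> w}" by (rule span_mono) auto
  finally show "y \<in> span {w. ?P \<mu> w}" .
qed

text \<open>A word of degree \<open>k\<close> in this weight space has \<open>n + k = m\<close>. As
  \<open>n\<close> is nonzero and \<open>m\<close> has total degree at most 1, \<open>k\<close> is
  zero, so only \<open>v0\<close> can occur, and only if \<open>m\<close> is nonzero.\<close>

lemma weight_above_simple_lowering:
  assumes "y \<in> weight_space D (\<lambda>x. (\<Lambda> x - nat_comb m x) + nat_comb n x)"
    and "\<exists>j. n j \<noteq> 0" and "(\<Sum>j\<in>UNIV. m j) \<le> 1"
  shows "y \<in> span (if \<forall>j. m j = 0 then {} else {v0})"
proof -
  have "{w. \<exists>k. (k, w) \<in> f_words \<and> (\<lambda>x. (\<Lambda> x - nat_comb m x) + nat_comb n x) = (\<lambda>x. \<Lambda> x - nat_comb k x)}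
      \<subseteq> (if \<forall>j. m j = 0 then {} else {v0})"
  proof clarify
    fix w k assume k: "(k, w) \<in> f_words"
      and eq: "(\<lambda>x. (\<Lambda> x - nat_comb m x) + nat_comb n x) = (\<lambda>x. \<Lambda> x - nat_comb k x)"
    have "root_comb D (\<lambda>j. real (n j) + real (k j)) = nat_comb m"
    proof
      fix x show "root_comb D (\<lambda>j. real (n j) + real (k j)) x = nat_comb m x"
        using fun_cong[OF eq, of x] by (simp add: root_comb_add)
    qed
    then have "real (n j) + real (k j) = real (m j)" for j
      unfolding root_comb_inject by (rule fun_cong)
    then have nk: "n j + k j = m j" for j by (metis of_nat_add of_nat_eq_iff)
    obtain j where j: "n j \<noteq> 0" using assms(2) by blast
    have "(\<Sum>j\<in>UNIV. n j) + (\<Sum>j\<in>UNIV. k j) \<le> 1"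
      using assms(3) by (simp add: nk[symmetric] sum.distrib)
    moreover have "n j \<le> (\<Sum>j\<in>UNIV. n j)" by (rule member_le_sum) auto
    ultimately have "(\<Sum>j\<in>UNIV. k j) = 0" using j by linarith
    then have "\<forall>j. k j = 0" by simp
    with f_word_zero[OF k] nk[of j] j show "w \<in> (if \<forall>j. m j = 0 then {} else {v0})" by auto
  qed
  then show ?thesis
    using weight_space_subset_span assms(1) span_mono by blast
qed

lemma unipotent_displacement:
  assumes u: "u \<in> unipotent_subgroup D" and v: "(m, v) \<in> f_words" and m: "(\<Sum>j\<in>UNIV. m j) \<le> 1"
  shows "u v - v \<in> span (if \<forall>j. m j = 0 then {} else {v0})"
proof -
  have v_wt: "v \<in> weight_space D (\<lambda>x. \<Lambda> x - nat_comb m x)"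
    using f_word_act_cart[OF v] by (simp add: weight_space_def)
  have unip: "\<forall>\<mu>. \<forall>v\<in>weight_space D \<mu>. u v - v \<in> span (\<Union>n\<in>{n :: 'i \<Rightarrow> nat. \<exists>i. n i \<noteq> 0}.
      weight_space D (\<lambda>x. \<mu> x + nat_comb n x))"
    using u by (simp add: unipotent_subgroup_def root_comb_def)
  have "u v - v \<in> span (\<Union>n\<in>{n :: 'i \<Rightarrow> nat. \<exists>i. n i \<noteq> 0}.
      weight_space D (\<lambda>x. (\<Lambda> x - nat_comb m x) + nat_comb n x))"
    by (rule unip[rule_format, OF v_wt])
  also have "\<dots> \<subseteq> span (if \<forall>j. m j = 0 then {} else {v0})"
  proof (rule span_minimal[OF _ subspace_span], intro UN_least subsetI)
    fix n y assume "n \<in> {n :: 'i \<Rightarrow> nat. \<exists>i. n i \<noteq> 0}"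
      "y \<in> weight_space D (\<lambda>x. (\<Lambda> x - nat_comb m x) + nat_comb n x)"
    then show "y \<in> span (if \<forall>j. m j = 0 then {} else {v0})"
      using m by (intro weight_above_simple_lowering) auto
  qed
  finally show ?thesis .
qed

section \<open>Action of the Iwasawa factors on the top weight vectors\<close>

lemma unipotent_v0:
  assumes "u \<in> unipotent_subgroup D"
  shows "u v0 = v0"
  using unipotent_displacement[OF assms f_words.top] by simp

text \<open>The weights of these vectors and of \<open>v0\<close> separate the points of the Cartan
  subalgebra, so the torus component can be read off from them.\<close>

definition v1 :: "'i \<Rightarrow> 'v" where "v1 i = act D (chev_f D i) v0"

lemma v1_f_word: "((\<lambda>_. 0)(i := Suc 0), v1 i) \<in> f_words"
  using f_words.step[OF f_words.top, of i] by (simp add: v1_def)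

lemma unipotent_v1:
  assumes "u \<in> unipotent_subgroup D"
  obtains t where "u (v1 i) = v1 i + t *\<^sub>R v0"
proof -
  have "u (v1 i) - v1 i \<in> span (if \<forall>j. ((\<lambda>_. 0)(i := Suc 0)) j = 0 then {} else {v0})"
    by (rule unipotent_displacement[OF assms v1_f_word]) (simp add: fun_upd_def)
  moreover have "\<not> (\<forall>j. ((\<lambda>_. 0)(i := Suc 0)) j = 0)" by auto
  ultimately have "u (v1 i) - v1 i \<in> span {v0}" by (simp only: if_False)
  then obtain t where "u (v1 i) - v1 i = t *\<^sub>R v0" by (auto simp: span_singleton)
  then show thesis using that[of t] by (simp add: algebra_simps)
qed

lemma v1_orthogonal: "v0 \<bullet> v1 i = 0"
  using contravariant[of i v0 v0] by (simp add: v1_def e_v0)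

text \<open>Applying \<open>e_i\<close> returns \<open>\<Lambda> (\<alpha>v i)\<close> times
  \<open>v0\<close>, a nonzero multiple because the highest weight is regular.\<close>

lemma v1_nonzero: "v1 i \<noteq> 0"
proof
  assume "v1 i = 0"
  then have "act D (chev_e D i) (v1 i) = 0" by (simp add: act_simps)
  then have "\<Lambda> (\<alpha>v i) *\<^sub>R v0 = 0" by (simp add: v1_def act_e_f e_v0 act_simps cart_v0)
  with Lambda_pos[of i] v0_nonzero show False by simp
qed

lemma torus_exp_f_word: "(n, v) \<in> f_words \<Longrightarrow> torus_exp D x v = exp (\<Lambda> x - nat_comb n x) *\<^sub>R v"
  unfolding torus_exp_def op_exp_def
  by (intro sums_unique[symmetric] op_exp_eigenvector linear_act f_word_act_cart)

lemma torus_exp_v0: "torus_exp D x v0 = exp (\<Lambda> x) *\<^sub>R v0"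
  using torus_exp_f_word[OF f_words.top] by simp

lemma torus_exp_v1: "torus_exp D x (v1 i) = exp (\<Lambda> x - \<alpha> i x) *\<^sub>R v1 i"
  using torus_exp_f_word[OF v1_f_word[of i], of x] by (simp only: sroot_eq_nat_comb)

text \<open>\<open>op_exp\<close> is a \<open>suminf\<close>, so convergence has to come first: it
  holds on weight vectors and passes to their span, which is the whole module.\<close>

lemma linear_torus_exp: "linear (torus_exp D x)"
proof -
  let ?T = "act D (cart D x)"
  have lin: "linear (?T ^^ n)" for n by (rule linear_funpow[OF linear_act])
  have add: "(?T ^^ n) (v + w) /\<^sub>R fact n = (?T ^^ n) v /\<^sub>R fact n + (?T ^^ n) w /\<^sub>R fact n" for n v w
    by (simp add: linear_add[OF lin] scaleR_add_right)
  have scale: "(?T ^^ n) (c *\<^sub>R v) /\<^sub>R fact n = c *\<^sub>R ((?T ^^ n) v /\<^sub>R fact n)" for n c v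
    by (simp add: linear_scale[OF lin])
  have "subspace {v. summable (\<lambda>n. (?T ^^ n) v /\<^sub>R fact n)}"
    unfolding subspace_def mem_Collect_eq add scale
    by (simp add: linear_0[OF lin] summable_add summable_scaleR_right del: scaleR_scaleR)
  moreover have "snd ` f_words \<subseteq> {v. summable (\<lambda>n. (?T ^^ n) v /\<^sub>R fact n)}"
    using sums_summable[OF op_exp_eigenvector[OF linear_act f_word_act_cart]] by force
  ultimately have "span (snd ` f_words) \<subseteq> {v. summable (\<lambda>n. (?T ^^ n) v /\<^sub>R fact n)}"
    by (intro span_minimal)
  then have sm: "summable (\<lambda>n. (?T ^^ n) v /\<^sub>R fact n)" for v by (auto simp: span_f_words)
  show ?thesis
    unfolding linear_iff torus_exp_def op_exp_def add scale
    by (intro conjI allI) (rule suminf_add[OF sm sm, symmetric], rule suminf_scaleR_right[OF sm, symmetric])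
qed

lemma inj_torus_exp_apply: "inj (torus_exp D x)"
proof (rule inj_on_inverseI)
  fix v
  have lin: "linear (\<lambda>v. torus_exp D (- x) (torus_exp D x v))"
    using linear_compose[OF linear_torus_exp[of x] linear_torus_exp[of "- x"]] by (simp add: o_def)
  have eq: "torus_exp D (- x) (torus_exp D x b) = id b" if "b \<in> snd ` f_words" for b
    using that by (auto simp: torus_exp_f_word linear_scale[OF linear_torus_exp]
        linear_neg[OF linear_Lambda] linear_neg[OF linear_root_comb] simp flip: exp_add)
  have "v \<in> span (snd ` f_words)" by (simp add: span_f_words)
  from linear_eq_on[OF lin linear_id this eq] show "torus_exp D (- x) (torus_exp D x v) = v" by simp
qed

lemma weights_separate:
  assumes "\<Lambda> x = \<Lambda> y" "\<And>i. \<Lambda> x - \<alpha> i x = \<Lambda> y - \<alpha> i y"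
  shows "x = y"
proof -
  have "\<alpha> i (x - y) = 0" for i using assms(1) assms(2)[of i] by (simp add: linear_diff[OF linear_sroot])
  then show ?thesis using sroots_separate[of "x - y"] by simp
qed

lemma inj_torus_exp: "inj (torus_exp D)"
proof (rule injI)
  fix x y assume eq: "torus_exp D x = torus_exp D y"
  show "x = y"
  proof (rule weights_separate)
    show "\<Lambda> x = \<Lambda> y"
      using torus_exp_v0[of x] torus_exp_v0[of y] v0_nonzero by (simp add: eq)
    show "\<Lambda> x - \<alpha> i x = \<Lambda> y - \<alpha> i y" for i
      using torus_exp_v1[of x i] torus_exp_v1[of y i] v1_nonzero[of i] by (simp add: eq)
  qed
qed

lemma torus_log_torus_exp [simp]: "torus_log D (torus_exp D x) = x"
  unfolding torus_log_def by (rule the_equality) (auto dest: injD[OF inj_torus_exp])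

text \<open>Choose \<open>p\<close> with \<open>k' p = v\<close>; then \<open>z = k p\<close> has
  the norm of \<open>v\<close>, and \<open>u (torus_exp D x z) = u' (torus_exp D y v)\<close>. For
  \<open>v = v0\<close> the solution \<open>z\<close> is a multiple of \<open>v0\<close>. For
  \<open>v1 i\<close> it has a further component along \<open>v0\<close>, orthogonal to
  \<open>v1 i\<close>, which can only lengthen it: hence an inequality, made an equality later by
  exchanging the two decompositions.\<close>

lemma iwasawa_weight_le:
  assumes u: "u \<in> unipotent_subgroup D" "u' \<in> unipotent_subgroup D"
    and k: "k \<in> unitary_subgroup D" "k' \<in> unitary_subgroup D"
    and eq: "u \<circ> torus_exp D x \<circ> k = u' \<circ> torus_exp D y \<circ> k'"
  shows "\<Lambda> y \<le> \<Lambda> x" "\<Lambda> y - \<alpha> i y \<le> \<Lambda> x - \<alpha> i x"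
proof -
  have lin: "linear u" "linear u'" and inj_u: "inj u"
    using u by (auto simp: unipotent_subgroup_def km_group_def bij_def)
  have surj: "surj k'" using k by (auto simp: unitary_subgroup_def km_group_def bij_def)
  have ex: "\<exists>z. u (torus_exp D x z) = u' (torus_exp D y v) \<and> z \<bullet> z = v \<bullet> v" for v
  proof -
    from surj obtain p where p: "k' p = v" by (metis surjD)
    have "k p \<bullet> k p = k' p \<bullet> k' p" using k by (simp add: unitary_subgroup_def)
    with fun_cong[OF eq, of p] p show ?thesis by auto
  qed
  have cancel: "z = w" if "u (torus_exp D x z) = u (torus_exp D x w)" for z w
    using that inj_u inj_torus_exp_apply[of x] by (auto dest: injD)
  have le: "d \<le> 0" if "exp d *\<^sub>R v \<bullet> exp d *\<^sub>R v \<le> v \<bullet> v" "v \<noteq> 0" for d and v :: 'v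
  proof -
    have "(exp d)\<^sup>2 * (v \<bullet> v) \<le> 1 * (v \<bullet> v)"
      using that(1) by (simp add: power2_eq_square mult.assoc)
    then have "(exp d)\<^sup>2 \<le> 1" using that(2) by (simp only: mult_le_cancel_right inner_gt_zero_iff) auto
    then show ?thesis by (simp flip: exp_double)
  qed
  show "\<Lambda> y \<le> \<Lambda> x"
  proof -
    from ex[of v0] obtain z where z: "u (torus_exp D x z) = u' (torus_exp D y v0)" "z \<bullet> z = v0 \<bullet> v0"
      by blast
    have "u' (torus_exp D y v0) = exp (\<Lambda> y) *\<^sub>R v0"
      by (simp add: torus_exp_v0 linear_scale[OF lin(2)] unipotent_v0[OF u(2)])
    also have "\<dots> = u (torus_exp D x (exp (\<Lambda> y - \<Lambda> x) *\<^sub>R v0))"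
      by (simp add: torus_exp_v0 linear_scale[OF linear_torus_exp] linear_scale[OF lin(1)]
          unipotent_v0[OF u(1)] flip: exp_add)
    finally have "z = exp (\<Lambda> y - \<Lambda> x) *\<^sub>R v0" using z cancel by simp
    with z le[of "\<Lambda> y - \<Lambda> x" v0] v0_nonzero show ?thesis by simp
  qed
  show "\<Lambda> y - \<alpha> i y \<le> \<Lambda> x - \<alpha> i x"
  proof -
    from ex[of "v1 i"] obtain z where z: "u (torus_exp D x z) = u' (torus_exp D y (v1 i))" "z \<bullet> z = v1 i \<bullet> v1 i"
      by blast
    obtain t where t: "u (v1 i) = v1 i + t *\<^sub>R v0" using unipotent_v1[OF u(1)] .
    obtain t' where t': "u' (v1 i) = v1 i + t' *\<^sub>R v0" using unipotent_v1[OF u(2)] .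
    let ?a = "\<Lambda> y - \<alpha> i y" and ?b = "\<Lambda> x - \<alpha> i x"
    \<comment> \<open>\<open>exp ?a * (t' - t)\<close> corrects for the different
      \<open>v0\<close>-shifts of \<open>u\<close> and \<open>u'\<close>; the factor
      \<open>exp (- \<Lambda> x)\<close> undoes \<open>torus_exp D x\<close> on
      \<open>v0\<close>.\<close>
    define c where "c = exp (- \<Lambda> x) * (exp ?a * (t' - t))"
    have "u' (torus_exp D y (v1 i)) = exp ?a *\<^sub>R (v1 i + t' *\<^sub>R v0)"
      by (simp add: torus_exp_v1 linear_scale[OF lin(2)] t')
    also have "\<dots> = u (exp ?a *\<^sub>R v1 i + (exp ?a * (t' - t)) *\<^sub>R v0)"
      unfolding linear_add[OF lin(1)] linear_scale[OF lin(1)] unipotent_v0[OF u(1)] t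
      by (simp add: algebra_simps)
    also have "exp ?a *\<^sub>R v1 i + (exp ?a * (t' - t)) *\<^sub>R v0
        = torus_exp D x (exp (?a - ?b) *\<^sub>R v1 i + c *\<^sub>R v0)"
    proof -
      have "exp (?a - ?b) * exp ?b = exp ?a" by (simp flip: exp_add)
      moreover have "c * exp (\<Lambda> x) = exp ?a * (t' - t)" by (simp add: c_def exp_minus field_simps)
      ultimately show ?thesis
        by (simp only: linear_add[OF linear_torus_exp] linear_scale[OF linear_torus_exp]
            torus_exp_v1 torus_exp_v0 scaleR_scaleR)
    qed
    finally have zeq: "z = exp (?a - ?b) *\<^sub>R v1 i + c *\<^sub>R v0" using z cancel by simp
    have orth: "v1 i \<bullet> v0 = 0" "v0 \<bullet> v1 i = 0" using v1_orthogonal[of i] by (simp_all add: inner_commute)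
    have "z \<bullet> z = (exp (?a - ?b) *\<^sub>R v1 i) \<bullet> (exp (?a - ?b) *\<^sub>R v1 i) + c\<^sup>2 * (v0 \<bullet> v0)"
      unfolding zeq inner_add_left inner_add_right by (simp add: orth power2_eq_square)
    moreover have "(exp (?a - ?b) *\<^sub>R v1 i) \<bullet> (exp (?a - ?b) *\<^sub>R v1 i) \<le> v1 i \<bullet> v1 i"
    proof -
      have "0 \<le> c\<^sup>2 * (v0 \<bullet> v0)" by simp
      with calculation z(2) show ?thesis by linarith
    qed
    ultimately show ?thesis using le[OF _ v1_nonzero] by fastforce
  qed
qed

lemma iwasawa_a_eq:
  assumes "u \<in> unipotent_subgroup D" "k \<in> unitary_subgroup D"
  shows "iwasawa_a D (u \<circ> torus_exp D x \<circ> k) = torus_exp D x"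
  unfolding iwasawa_a_def
proof (rule the_equality)
  show "torus_exp D x \<in> range (torus_exp D) \<and> (\<exists>u'\<in>unipotent_subgroup D. \<exists>k'\<in>unitary_subgroup D.
      u \<circ> torus_exp D x \<circ> k = u' \<circ> torus_exp D x \<circ> k')"
    using assms by blast
  fix a assume "a \<in> range (torus_exp D) \<and> (\<exists>u'\<in>unipotent_subgroup D. \<exists>k'\<in>unitary_subgroup D.
      u \<circ> torus_exp D x \<circ> k = u' \<circ> a \<circ> k')"
  then obtain y u' k' where a: "a = torus_exp D y" and uk: "u' \<in> unipotent_subgroup D" "k' \<in> unitary_subgroup D"
    and eq: "u \<circ> torus_exp D x \<circ> k = u' \<circ> torus_exp D y \<circ> k'" by blast
  have "x = y"
    using iwasawa_weight_le[OF assms(1) uk(1) assms(2) uk(2) eq]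
      iwasawa_weight_le[OF uk(1) assms(1) uk(2) assms(2) eq[symmetric]]
    by (intro weights_separate antisym)
  with a show "a = torus_exp D x" by simp
qed

end

section \<open>Boundedness of the coefficients and convergence\<close>

context km_weyl
begin

lemma pos_root_coefficients:
  assumes "\<beta> \<in> pos_roots D"
  obtains n :: "'i \<Rightarrow> nat" and j where "\<beta> = nat_comb n" "n j \<noteq> 0"
proof -
  obtain n :: "'i \<Rightarrow> nat" where n: "\<beta> = nat_comb n"
    using assms by (auto simp: pos_roots_def root_comb_def[abs_def])
  have "\<exists>j. n j \<noteq> 0"
  proof (rule ccontr)
    assume "\<nexists>j. n j \<noteq> 0"
    then have "\<beta> = (\<lambda>_. 0)" by (simp add: n root_comb_def fun_eq_iff)
    with assms show False by (simp add: pos_roots_def roots_def)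
  qed
  with n that show thesis by blast
qed

lemma neg_roots_not_pos:
  assumes "\<gamma> \<in> neg_roots D"
  shows "\<gamma> \<notin> pos_roots D"
proof
  assume "\<gamma> \<in> pos_roots D"
  then obtain n :: "'i \<Rightarrow> nat" and j where n: "\<gamma> = nat_comb n" "n j \<noteq> 0"
    by (rule pos_root_coefficients)
  from assms obtain m :: "'i \<Rightarrow> nat" where m: "\<gamma> = (\<lambda>x. - nat_comb m x)"
    by (auto simp: neg_roots_def elim!: pos_root_coefficients)
  have "nat_comb n = root_comb D (\<lambda>j. (-1) * real (m j))"
    using n m by (simp only: root_comb_scale fun_eq_iff) simp
  then have "real (n j) = (-1) * real (m j)"
    unfolding root_comb_inject by (rule fun_cong)
  with n show False by simp
qed

text \<open>The inverse word of \<open>w\<close> makes \<open>\<beta>\<close> negative, so some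
  prefix of it turns \<open>\<beta>\<close> into a simple root. Hence \<open>\<beta>\<close> is real
  and \<open>coroot\<close> is meaningful on it.\<close>

lemma inversion_set_real:
  assumes "w \<in> weyl_group D" "\<beta> \<in> inversion_set D w"
  obtains i us where "\<beta> = \<alpha> i \<circ> W us" "\<beta> \<in> pos_roots D"
proof -
  obtain xs where xs: "w = W xs" using assms by (auto simp: weyl_group_eq)
  from assms obtain \<gamma> where pos: "\<beta> \<in> pos_roots D" and \<gamma>: "\<gamma> \<in> neg_roots D" "\<beta> = \<gamma> \<circ> W xs"
    by (auto simp: inversion_set_def dual_act_def xs inv_inv_eq[OF bij_W])
  have "\<beta> \<circ> W (rev xs) = \<gamma>" by (simp add: \<gamma>(2) fun_eq_iff)
  with \<gamma>(1) neg_roots_not_pos have "\<beta> \<circ> W (rev xs) \<notin> pos_roots D" by simp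
  from pos_root_turned_negative[OF pos this] obtain us k where "\<beta> \<circ> W us = \<alpha> k" .
  then have "\<beta> = \<alpha> k \<circ> W (rev us)" by (metis W_W_rev comp_apply ext)
  with pos that show thesis by blast
qed

text \<open>A factor exceeds 1 in absolute value only for the finitely many real roots whose coroots are
  small, so the same finite product bounds all coefficients.\<close>

lemma c_factor_bounded:
  fixes \<mu> :: "'h \<Rightarrow> complex"
  assumes \<mu>: "linear \<mu>" and gt: "\<And>i. Re (\<mu> (\<alpha>v i)) > 1"
  obtains K where "K \<ge> 0" "\<And>w. w \<in> weyl_group D \<Longrightarrow> norm (c_factor D \<mu> w) \<le> K"
proof -
  define a where "a = Min (range (\<lambda>i. Re (\<mu> (\<alpha>v i))))"
  have a: "a > 1" "\<And>i. a \<le> Re (\<mu> (\<alpha>v i))"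
    using gt by (auto simp: a_def)
  \<comment> \<open>The smallest factor by which a coefficient can change between a root and its
    coroot.\<close>
  define \<kappa> where "\<kappa> = Min (range (\<lambda>(i, j). eps i / eps j))"
  have \<kappa>: "\<kappa> > 0"
    unfolding \<kappa>_def using eps_pos by (subst Min_gr_iff) auto
  have \<kappa>_le: "\<kappa> \<le> eps i / eps j" for i j
    unfolding \<kappa>_def by (rule Min_le) (auto intro: range_eqI[of _ _ "(i, j)"])
  obtain K where K: "K > 0"
    "\<And>s. Re s \<ge> a \<Longrightarrow> norm (completed_zeta s / completed_zeta (1 + s)) \<le> K / sqrt (Re s - 1)"
    using completed_zeta_quotient_bound[OF a(1)] by metis
  \<comment> \<open>All arguments have real part at least \<open>a\<close>, so \<open>M\<close>
    bounds every factor; the \<open>max\<close> with 1 makes its powers increasing.\<close>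
  define M where "M = max 1 (K / sqrt (a - 1))"
  \<comment> \<open>A coefficient above \<open>N\<close> forces the real part of the argument up to
    at least \<open>1 + K^2\<close>, where \<open>K / sqrt (Re s - 1)\<close> is at most 1.\<close>
  define N where "N = nat \<lceil>(1 + K\<^sup>2) / \<kappa>\<rceil>"
  \<comment> \<open>All combinations with coefficients up to \<open>N\<close>, roots or not: a
    finite set independent of \<open>w\<close>.\<close>
  define Bad where "Bad = (\<lambda>n :: 'i \<Rightarrow> nat. nat_comb n) ` (PiE UNIV (\<lambda>_. {..N}))"
  let ?q = "\<lambda>\<beta>. completed_zeta (\<mu> (coroot D \<beta>)) / completed_zeta (1 + \<mu> (coroot D \<beta>))"
  have fin: "finite Bad" unfolding Bad_def by (intro finite_imageI finite_PiE) auto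
  have factor: "norm (?q \<beta>) \<le> (if \<beta> \<in> Bad then M else 1)"
    if w: "w \<in> weyl_group D" and \<beta>: "\<beta> \<in> inversion_set D w" for w \<beta>
  proof -
    obtain i us where i: "\<beta> = \<alpha> i \<circ> W us" and pos: "\<beta> \<in> pos_roots D"
      using inversion_set_real[OF w \<beta>] .
    obtain n j0 where n: "\<beta> = nat_comb n" "n j0 \<noteq> 0" using pos by (rule pos_root_coefficients)
    let ?y = "coroot D \<beta>"
    have y: "?y = W (rev us) (\<alpha>v i)" unfolding i by (rule coroot_real_root)
    have co: "coord j ?y = real (n j) * (eps i / eps j)" for j
      unfolding y by (rule real_coroot_coord) (use i n in simp)
    have co_ge: "coord j ?y \<ge> real (n j) * \<kappa>" for j
      unfolding co by (intro mult_left_mono \<kappa>_le) auto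
    have co_nonneg: "coord j ?y \<ge> 0" for j
      using co_ge[of j] \<kappa> by (meson mult_nonneg_nonneg of_nat_0_le_iff less_imp_le order_trans)
    have "linear (\<lambda>x. Re (\<mu> x))"
      using linear_compose[OF \<mu> bounded_linear.linear[OF bounded_linear_Re]] by (simp add: o_def)
    from linear_coord_expansion[OF this, of ?y]
    have re: "Re (\<mu> ?y) = (\<Sum>j\<in>UNIV. coord j ?y * Re (\<mu> (\<alpha>v j)))" by simp
    have part: "coord j ?y * Re (\<mu> (\<alpha>v j)) \<le> Re (\<mu> ?y)" for j
      unfolding re
      by (rule member_le_sum) (use co_nonneg gt in \<open>auto intro!: mult_nonneg_nonneg intro: less_imp_le order_trans[OF zero_le_one]\<close>)
    have ge_a: "Re (\<mu> ?y) \<ge> a"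
    proof -
      have "coord j0 ?y > 0" unfolding co using n(2) eps_pos by simp
      moreover have "coord j0 ?y \<in> \<int>" unfolding y by (rule coord_W_scoroot_int)
      ultimately have "coord j0 ?y \<ge> 1" by (auto elim!: Ints_cases)
      then have "1 * a \<le> coord j0 ?y * Re (\<mu> (\<alpha>v j0))"
        using a by (intro mult_mono) auto
      with part[of j0] show ?thesis by simp
    qed
    from K(2)[OF this] have bound: "norm (?q \<beta>) \<le> K / sqrt (Re (\<mu> ?y) - 1)" .
    show ?thesis
    proof (cases "\<beta> \<in> Bad")
      case True
      have "K / sqrt (Re (\<mu> ?y) - 1) \<le> K / sqrt (a - 1)"
        using ge_a a(1) K(1) by (intro divide_left_mono) auto
      with bound True show ?thesis by (simp add: M_def)
    next
      case False
      then obtain j where "\<not> n j \<le> N" unfolding n(1) Bad_def by (auto simp: PiE_def)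
      then have "real (n j) \<ge> (1 + K\<^sup>2) / \<kappa>" unfolding N_def by linarith
      then have "1 + K\<^sup>2 \<le> real (n j) * \<kappa>" using \<kappa> by (simp add: field_simps)
      also have "\<dots> \<le> coord j ?y" by (rule co_ge)
      also have "\<dots> \<le> coord j ?y * Re (\<mu> (\<alpha>v j))"
        using co_nonneg[of j] gt[of j] mult_left_mono[of 1 "Re (\<mu> (\<alpha>v j))" "coord j ?y"] by simp
      also have "\<dots> \<le> Re (\<mu> ?y)" by (rule part)
      finally have "sqrt (K\<^sup>2) \<le> sqrt (Re (\<mu> ?y) - 1)" by (intro real_sqrt_le_mono) simp
      then have "K \<le> sqrt (Re (\<mu> ?y) - 1)" using K(1) by simp
      then have "K / sqrt (Re (\<mu> ?y) - 1) \<le> 1" using ge_a a(1) by (simp add: divide_le_eq_1)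
      with bound False show ?thesis by simp
    qed
  qed
  show thesis
  proof (rule that)
    show "0 \<le> M ^ card Bad" by (simp add: M_def)
    fix w assume w: "w \<in> weyl_group D"
    show "norm (c_factor D \<mu> w) \<le> M ^ card Bad"
    proof (cases "finite (inversion_set D w)")
      case True
      have "norm (c_factor D \<mu> w) = (\<Prod>\<beta>\<in>inversion_set D w. norm (?q \<beta>))"
        unfolding c_factor_def by (simp add: prod_norm)
      also have "\<dots> \<le> (\<Prod>\<beta>\<in>inversion_set D w. if \<beta> \<in> Bad then M else 1)"
        using factor[OF w] by (intro prod_mono) auto
      also have "\<dots> = M ^ card (inversion_set D w \<inter> Bad)"
        using True by (simp add: prod.If_cases)
      also have "\<dots> \<le> M ^ card Bad"
        using fin by (intro power_increasing card_mono) (auto simp: M_def)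
      finally show ?thesis .
    next
      case False \<comment> \<open>vacuous, but harmless: such a product would be 1\<close>
      then show ?thesis by (simp add: c_factor_def M_def one_le_power)
    qed
  qed
qed

end

text \<open>A term depends on \<open>g\<close> only through the logarithm of its Iwasawa component,
  which lies in \<open>C\<close>. Compactness bounds the factor from rho there, and the rest is the
  exponential sum times a bounded coefficient.\<close>

lemma (in km_module) E_sharp_term_majorant:
  fixes \<rho> :: "'h \<Rightarrow> real" and \<mu> :: "'h \<Rightarrow> complex"
  assumes \<rho>: "linear \<rho>" and \<mu>: "linear \<mu>" and gt: "\<And>i. Re (\<mu> (\<alpha>v i)) > 1"
    and C: "compact C" "C \<subseteq> interior (tits_cone D)"
  obtains M where "M summable_on weyl_group D"
    "\<And>w g. w \<in> weyl_group D \<Longrightarrow> iwasawa_a D g \<in> torus_exp D ` C \<Longrightarrow> norm (E_sharp_term D \<rho> \<mu> g w) \<le> M w"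
proof -
  obtain K where K: "K \<ge> 0" "\<And>w. w \<in> weyl_group D \<Longrightarrow> norm (c_factor D \<mu> w) \<le> K"
    using c_factor_bounded[OF \<mu> gt] by metis
  have L: "linear (\<lambda>x. Re (\<mu> x))"
    using linear_compose[OF \<mu> bounded_linear.linear[OF bounded_linear_Re]] by (simp add: o_def)
  obtain M where M: "M summable_on weyl_group D"
    "\<And>w x. w \<in> weyl_group D \<Longrightarrow> x \<in> C \<Longrightarrow> exp (Re (\<mu> (inv w x))) \<le> M w"
    using weyl_exp_sum_majorant[OF L _ C] gt by (metis less_imp_le)
  have "bounded ((\<lambda>x. exp (\<rho> x)) ` C)"
    by (intro compact_imp_bounded compact_continuous_image C continuous_on_exp linear_continuous_on
        linear_conv_bounded_linear[THEN iffD1] \<rho>)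
  then obtain R where "\<forall>y\<in>(\<lambda>x. exp (\<rho> x)) ` C. norm y \<le> R" unfolding bounded_iff by blast
  then have R: "exp (\<rho> x) \<le> R" if "x \<in> C" for x using that by auto
  show thesis
  proof (rule that)
    show "(\<lambda>w. R * K * M w) summable_on weyl_group D"
      by (intro summable_on_cmult_right M)
    fix w g assume w: "w \<in> weyl_group D" and "iwasawa_a D g \<in> torus_exp D ` C"
    then obtain x where x: "x \<in> C" "iwasawa_a D g = torus_exp D x" by blast
    have "norm (E_sharp_term D \<rho> \<mu> g w) = exp (\<rho> x) * norm (c_factor D \<mu> w) * exp (Re (\<mu> (inv w x)))"
      by (simp add: E_sharp_term_def torus_power_def x dual_act_def norm_mult exp_add)
    also have "\<dots> \<le> R * K * M w"
      using R[OF x(1)] exp_ge_zero[of "\<rho> x"] K(1)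
      by (intro mult_mono K(2)[OF w] M(2)[OF w x(1)] mult_nonneg_nonneg R[OF x(1)]) (auto intro: order_trans[OF exp_ge_zero])
    finally show "norm (E_sharp_term D \<rho> \<mu> g w) \<le> R * K * M w" .
  qed
qed

theorem theorem3p3:
  fixes D :: "('i::finite, 'h::euclidean_space, 'g::real_vector, 'v::real_inner) kac_moody_datum"
    and \<rho> :: "'h \<Rightarrow> real" and \<mu> :: "'h \<Rightarrow> complex"
  assumes "generalized_cartan_matrix (cartan D)"
    and "symmetrizable (cartan D)"
    and "det (cartan D) \<noteq> 0"
    and "realization D"
    and "kac_moody_algebra D"
    and "highest_weight_module D"
    and "linear \<rho>" and "\<And>i. \<rho> (scoroot D i) = 1"
    and "linear \<mu>" and "(\<lambda>x. Re (\<mu> x - of_real (\<rho> x))) \<in> dual_chamber D"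
  shows "(\<forall>g\<in>tits_domain D. (\<lambda>w. norm (E_sharp_term D \<rho> \<mu> g w)) summable_on weyl_group D) \<and>
    (\<forall>C. compact C \<and> C \<subseteq> interior (tits_cone D) \<longrightarrow>
       uniform_limit {g \<in> tits_domain D. iwasawa_a D g \<in> torus_exp D ` C}
         (\<lambda>F g. \<Sum>w\<in>F. E_sharp_term D \<rho> \<mu> g w) (E_sharp D \<rho> \<mu>)
         (finite_subsets_at_top (weyl_group D)))"
proof -
  have "\<exists>\<Lambda> v0. linear \<Lambda> \<and> (\<forall>i. \<exists>n::nat. n > 0 \<and> \<Lambda> (scoroot D i) = real n) \<and>
      v0 \<noteq> 0 \<and> (\<forall>x. act D (cart D x) v0 = \<Lambda> x *\<^sub>R v0) \<and> (\<forall>i. act D (chev_e D i) v0 = 0)"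
    using \<open>highest_weight_module D\<close> unfolding highest_weight_module_def by (elim conjE)
  then obtain \<Lambda> v0 where hw: "linear \<Lambda>"
    "\<And>i. \<exists>n::nat. n > 0 \<and> \<Lambda> (scoroot D i) = real n" "v0 \<noteq> 0"
    "\<And>x. act D (cart D x) v0 = \<Lambda> x *\<^sub>R v0" "\<And>i. act D (chev_e D i) v0 = 0"
    by (elim exE conjE) blast
  have pos: "\<Lambda> (scoroot D i) > 0" for i using hw(2)[of i] by auto
  interpret km_module D \<Lambda> v0
    by (intro km_module.intro km_weyl.intro km_algebra.intro km_weyl_axioms.intro
        km_module_axioms.intro) (fact assms hw pos)+
  have gt: "Re (\<mu> (scoroot D i)) > 1" for i
  proof -
    have "\<rho> (scoroot D i) < Re (\<mu> (scoroot D i))" using assms(10) by (simp add: dual_chamber_def)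
    then show ?thesis by (simp only: assms(8))
  qed
  show ?thesis
  proof (intro conjI ballI allI impI)
    fix g assume "g \<in> tits_domain D"
    then obtain u x k where g: "g = u \<circ> torus_exp D x \<circ> k" "u \<in> unipotent_subgroup D"
      "k \<in> unitary_subgroup D" and x: "x \<in> interior (tits_cone D)"
      by (auto simp: tits_domain_def)
    \<comment> \<open>Absolute convergence at a single \<open>g\<close> is the majorant for the
      compact set \<open>{x}\<close>.\<close>
    obtain M where M: "M summable_on weyl_group D"
      "\<And>w g. w \<in> weyl_group D \<Longrightarrow> iwasawa_a D g \<in> torus_exp D ` {x} \<Longrightarrow> norm (E_sharp_term D \<rho> \<mu> g w) \<le> M w"
      using E_sharp_term_majorant[OF assms(7,9) gt, of "{x}"] x by auto
    show "(\<lambda>w. norm (E_sharp_term D \<rho> \<mu> g w)) summable_on weyl_group D"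
      using M(1) by (rule summable_on_comparison_test) (use M(2)[of _ g] iwasawa_a_eq[OF g(2,3)] g(1) in auto)
  next
    fix C assume C: "compact C \<and> C \<subseteq> interior (tits_cone D)"
    then obtain M where M: "M summable_on weyl_group D"
      "\<And>w g. w \<in> weyl_group D \<Longrightarrow> iwasawa_a D g \<in> torus_exp D ` C \<Longrightarrow> norm (E_sharp_term D \<rho> \<mu> g w) \<le> M w"
      using E_sharp_term_majorant[OF assms(7,9) gt, of C] by auto
    show "uniform_limit {g \<in> tits_domain D. iwasawa_a D g \<in> torus_exp D ` C}
         (\<lambda>F g. \<Sum>w\<in>F. E_sharp_term D \<rho> \<mu> g w) (E_sharp D \<rho> \<mu>)
         (finite_subsets_at_top (weyl_group D))"
      unfolding E_sharp_def[abs_def] by (rule Weierstrass_m_test_general[OF _ M(1)]) (use M(2) in auto)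
  qed
qed

end
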